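(* Let $\lambda E-(J-R)\in\mathcal L$, i.e., $E,R\in\mathbb R^{n,n}$ are symmetric positive semidefinite and $J=-J^\top\in\mathbb R^{n,n}$. Then the following statements hold. (i) The infimum defining the structured distance to singularity $d_{\mathrm{sing}}^{\mathcal L}(\lambda E-(J-R))$ is attained with a perturbation $\Delta_L(\lambda)=\lambda\Delta_E-(\Delta_J-\Delta_R)$ where $\Delta_E=\Delta_E^u$, $\Delta_J=\Delta_J^u$, $\Delta_R=\Delta_R^u$ for some $u\in\mathbb R^n$ with $\|u\|_2=1$. The distance is given by $$d_{\mathrm{sing}}^{\mathcal L}\big(\lambda E-(J-R)\big)=\min_{u\in\mathbb R^n,\ \|u\|=1}\sqrt{2\|Ju\|^2+2\|(I-uu^\top)Eu\|^2+(u^\top Eu)^2+2\|(I-uu^\top)Ru\|^2+(u^\top Ru)^2}$$ and is bounded as $$\sqrt{\lambda_{\min}(-J^2+R^2+E^2)}\leq d_{\mathrm{sing}}^{\mathcal L}\big(\lambda E-(J-R)\big)\leq\sqrt{2\cdot\lambda_{\min}(-J^2+R^2+E^2)}.$$ (ii) The structured distance to higher index and the structured distance to instability coincide and satisfy $$d_{\mathrm{hi}}^{\mathcal L}\big(\lambda E-(J-R)\big)=d_{\mathrm{inst}}^{\mathcal L}\big(\lambda E-(J-R)\big)=\min_{u\in\mathbb R^n,\ \|u\|=1}\sqrt{2\|(I-uu^\top)Eu\|^2+(u^\top Eu)^2+2\|(I-uu^\top)Ru\|^2+(u^\top Ru)^2}$$ and are bounded as $$\sqrt{\lambda_{\min}(E^2+R^2)}\leq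 d_{\mathrm{hi}}^{\mathcal L}\big(\lambda E-(J-R)\big)=d_{\mathrm{inst}}^{\mathcal L}\big(\lambda E-(J-R)\big)\leq\sqrt{2\cdot\lambda_{\min}(E^2+R^2)}.$$
   Context: $\mathcal L$ is the class of real $n\times n$ pencils $\lambda E-(J-R)$ with $E,R$ symmetric positive semidefinite and $J$ skew-symmetric. For $Y\in\mathbb R^{n,n}$ and $u\in\mathbb R^n$ with $\|u\|_2=1$, $\Delta_Y^u:=-uu^\top Y-Yuu^\top+uu^\top Yuu^\top$. $\|\cdot\|_F$ is the Frobenius norm, $\|\lambda X_1+X_0\|_F:=\|[X_0,X_1]\|_F$ for a pencil, $\|\cdot\|=\|\cdot\|_2$ is the Euclidean norm for vectors, and $\lambda_{\min}(X)$ is the smallest eigenvalue of a symmetric positive semidefinite matrix $X$. A pencil $\lambda E-A$ is singular if $\det(\lambda E-A)\equiv0$, and regular otherwise. Its index is the size of its largest Kronecker block associated with the eigenvalue $\infty$ in the Kronecker canonical form ($0$ if there is none). A pencil is stable if it is regular, all its finite eigenvalues lie in the closed left half plane, and all eigenvalues on the imaginary axis (including $\infty$) have largest associated Jordan block of size at most one; otherwise it is unstable. For $L(\lambda)\in\mathcal L$, with $\Delta_L(\lambda)$ ranging over real $n\times n$ pencils: $d_{\mathrm{sing}}^{\mathcal L}(L):=\inf\{\|\Delta_L(\lambda)\|_F : L(\lambda)+\Delta_L(\lambda)\in\mathcal L\text{ is singular}\}$; $d_{\mathrm{hi}}^{\mathcal L}(L):=\inf\{\|\Delta_L(\lambda)\|_F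 : L(\lambda)+\Delta_L(\lambda)\in\mathcal L\text{ is of index}\geq2\}$; $d_{\mathrm{inst}}^{\mathcal L}(L):=\inf\{\|\Delta_L(\lambda)\|_F : L(\lambda)+\Delta_L(\lambda)\in\mathcal L\text{ is unstable}\}$.
   Formalization: The claims about the distance to higher index in (ii) are stated only for n ≥ 2: for n = 1 no pencil has index ≥ 2, so that distance is infinite while the distance to instability is finite; all other claims hold for every n ≥ 1. *)

theory Defs
  imports "HOL-Analysis.Analysis" "Jordan_Normal_Form.Jordan_Normal_Form"
begin

text \<open>
  The names \<open>mat\<close> and \<open>det\<close> exist both for the type-indexed matrices of HOL-Analysis and for
  the matrices with explicit dimensions of Jordan_Normal_Form.  After the following declarations
  the short names refer to HOL-Analysis.
\<close>

hide_const (open) Matrix.mat Matrix.vec Determinant.det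
no_notation Matrix.vec_index (infixl \<open>$\<close> 100)
no_notation Matrix.scalar_prod (infix \<open>\<bullet>\<close> 70)

text \<open>
  A pair \<open>(E, A)\<close> stands for the pencil \<open>\<lambda>E - A\<close>; pencils are added componentwise.  The library
  norm on \<open>real^'n^'n\<close> is the Frobenius norm, and on pairs it is
  \<open>norm (E, A) = sqrt ((norm E)\<^sup>2 + (norm A)\<^sup>2)\<close>, which is the Frobenius norm of the
  block matrix \<open>[-A, E]\<close>.
\<close>

type_synonym 'n pencil = "(real^'n^'n) \<times> (real^'n^'n)"

definition psd :: "real^'n^'n \<Rightarrow> bool" where
  "psd X \<longleftrightarrow> transpose X = X \<and> (\<forall>x. 0 \<le> x \<bullet> (X *v x))"

definition skew :: "real^'n^'n \<Rightarrow> bool" where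
  "skew X \<longleftrightarrow> transpose X = - X"

definition dh_pencils :: "'n::finite pencil set" where
  "dh_pencils = {(E, J - R) | E J R. psd E \<and> skew J \<and> psd R}"

abbreviation complexify :: "real^'n^'m \<Rightarrow> complex^'n^'m" where
  "complexify \<equiv> map_matrix complex_of_real"

definition pencil_at :: "'n pencil \<Rightarrow> complex \<Rightarrow> complex^'n^'n" where
  "pencil_at L z = (\<chi> i j. z * complexify (fst L) $ i $ j - complexify (snd L) $ i $ j)"

definition singular_pencil :: "'n::finite pencil \<Rightarrow> bool" where
  "singular_pencil L \<longleftrightarrow> (\<forall>z. det (pencil_at L z) = 0)"

definition finite_eigenvalue :: "'n::finite pencil \<Rightarrow> complex \<Rightarrow> bool" where
  "finite_eigenvalue L z \<longleftrightarrow> det (pencil_at L z) = 0"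

text \<open>
  The four types of blocks, written as \<open>\<lambda> * block_E b - block_A b\<close>:
  \<open>Right k\<close> is the \<open>k \<times> (k+1)\<close> block \<open>\<lambda>[I, 0] - [0, I]\<close>, \<open>Left k\<close> is its transpose,
  \<open>Finite z k\<close> is \<open>\<lambda>I - J\<^sub>k(z)\<close> and \<open>Infinite k\<close> is \<open>\<lambda>J\<^sub>k(0) - I\<close>.  The blocks \<open>Right 0\<close> and
  \<open>Left 0\<close> have dimensions \<open>0 \<times> 1\<close> and \<open>1 \<times> 0\<close> and contribute a zero column or a zero row.
\<close>

datatype kronecker_block = Right nat | Left nat | Finite complex nat | Infinite nat

fun block_E :: "kronecker_block \<Rightarrow> complex mat" where
  "block_E (Right k) = Matrix.mat k (k + 1) (\<lambda>(i, j). if j = i then 1 else 0)"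
| "block_E (Left k) = Matrix.mat (k + 1) k (\<lambda>(i, j). if i = j then 1 else 0)"
| "block_E (Finite z k) = 1\<^sub>m k"
| "block_E (Infinite k) = jordan_block k 0"

fun block_A :: "kronecker_block \<Rightarrow> complex mat" where
  "block_A (Right k) = Matrix.mat k (k + 1) (\<lambda>(i, j). if j = i + 1 then 1 else 0)"
| "block_A (Left k) = Matrix.mat (k + 1) k (\<lambda>(i, j). if i = j + 1 then 1 else 0)"
| "block_A (Finite z k) = jordan_block k z"
| "block_A (Infinite k) = 1\<^sub>m k"

fun proper_block :: "kronecker_block \<Rightarrow> bool" where
  "proper_block (Right k) = True"
| "proper_block (Left k) = True"
| "proper_block (Finite z k) = (0 < k)"
| "proper_block (Infinite k) = (0 < k)"

text \<open>
  \<open>bs\<close> lists the diagonal blocks of a Kronecker canonical form of \<open>L\<close> under strict equivalence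
  over the complex numbers.  The bijection \<open>f\<close> only numbers the elements of the index type by
  \<open>0, \<dots>, n - 1\<close>.
\<close>

definition kronecker_form :: "'n::finite pencil \<Rightarrow> kronecker_block list \<Rightarrow> bool" where
  "kronecker_form L bs \<longleftrightarrow>
     (let KE = diag_block_mat (map block_E bs); KA = diag_block_mat (map block_A bs) in
      (\<forall>b \<in> set bs. proper_block b) \<and>
      KE \<in> carrier_mat CARD('n) CARD('n) \<and> KA \<in> carrier_mat CARD('n) CARD('n) \<and>
      (\<exists>(P :: complex^'n^'n) (Q :: complex^'n^'n) (f :: 'n \<Rightarrow> nat).
         invertible P \<and> invertible Q \<and> bij_betw f UNIV {..<CARD('n)} \<and>
         P ** complexify (fst L) ** Q = (\<chi> i j. KE $$ (f i, f j)) \<and>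
         P ** complexify (snd L) ** Q = (\<chi> i j. KA $$ (f i, f j))))"

text \<open>
  Up to a permutation of the blocks there is exactly one list \<open>bs\<close> with \<open>kronecker_form L bs\<close>, so the
  existential quantifiers below range over the blocks of the Kronecker canonical form of \<open>L\<close>.
\<close>

definition pencil_index :: "'n::finite pencil \<Rightarrow> nat" where
  "pencil_index L = Max (insert 0 {k. \<exists>bs. kronecker_form L bs \<and> Infinite k \<in> set bs})"

definition max_jordan_block :: "'n::finite pencil \<Rightarrow> complex \<Rightarrow> nat" where
  "max_jordan_block L z = Max (insert 0 {k. \<exists>bs. kronecker_form L bs \<and> Finite z k \<in> set bs})"

definition stable_pencil :: "'n::finite pencil \<Rightarrow> bool" where
  "stable_pencil L \<longleftrightarrow>
     \<not> singular_pencil L \<and>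
     (\<forall>z. finite_eigenvalue L z \<longrightarrow> Re z \<le> 0) \<and>
     (\<forall>z. finite_eigenvalue L z \<and> Re z = 0 \<longrightarrow> max_jordan_block L z \<le> 1) \<and>
     pencil_index L \<le> 1"

text \<open>The infima are taken in the extended reals, so the infimum of the empty set is \<open>\<infinity>\<close>.
  In particular \<open>d_hi\<close> is \<open>\<infinity>\<close> for \<open>1 \<times> 1\<close> pencils, since none of these has index at least 2.\<close>

definition d_sing :: "'n::finite pencil \<Rightarrow> ereal" where
  "d_sing L = Inf {ereal (norm D) | D. L + D \<in> dh_pencils \<and> singular_pencil (L + D)}"

definition d_hi :: "'n::finite pencil \<Rightarrow> ereal" where
  "d_hi L = Inf {ereal (norm D) | D. L + D \<in> dh_pencils \<and> 2 \<le> pencil_index (L + D)}"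

definition d_inst :: "'n::finite pencil \<Rightarrow> ereal" where
  "d_inst L = Inf {ereal (norm D) | D. L + D \<in> dh_pencils \<and> \<not> stable_pencil (L + D)}"

definition outer :: "real^'n \<Rightarrow> real^'n^'n" where
  "outer u = (\<chi> i j. u $ i * u $ j)"

definition Delta :: "real^'n \<Rightarrow> real^'n^'n \<Rightarrow> real^'n^'n" where
  "Delta u Y = - (outer u ** Y) - Y ** outer u + outer u ** Y ** outer u"

definition lambda_min :: "real^'n^'n \<Rightarrow> real" where
  "lambda_min X = Min {c. \<exists>v. v \<noteq> 0 \<and> X *v v = c *\<^sub>R v}"

definition is_minimum :: "('a \<Rightarrow> real) \<Rightarrow> 'a set \<Rightarrow> real \<Rightarrow> bool" where
  "is_minimum f S m \<longleftrightarrow> (\<exists>x \<in> S. f x = m) \<and> (\<forall>x \<in> S. m \<le> f x)"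

end

theory Submission
  imports "Jordan_Normal_Form.Jordan_Normal_Form_Existence" Defs
begin

text \<open>
  Two mechanisms carry the proof: a pencil \<open>\<lambda>E - (J - R)\<close> with \<open>E\<close>, \<open>R\<close> positive semidefinite and
  \<open>J\<close> skew can degenerate only along a common kernel vector, and the cheapest way to create
  such a vector is an orthogonal compression.

  \<^emph>\<open>Degeneration means a common kernel.\<close>  If \<open>v = a + \<i>b\<close> satisfies \<open>(J - R)v = z E v\<close>, then taking the real
  part of the inner product with \<open>v\<close> removes \<open>J\<close> and leaves
  \<open>Re z (a\<bullet>Ea + b\<bullet>Eb) + (a\<bullet>Ra + b\<bullet>Rb) = 0\<close> (\<open>eigenvector_energy\<close>).  For \<open>Re z > 0\<close> all four terms vanish,
  and a positive semidefinite matrix annihilates the zeros of its quadratic form (\<open>psd_kernel\<close>), so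
  \<open>E\<close>, \<open>R\<close> and then \<open>J\<close> share a real kernel vector.  This characterizes singular pencils
  (\<open>singular_iff_common_kernel\<close>).  The same computation applied to a Jordan chain of length two at an imaginary
  eigenvalue or at infinity gives a common kernel vector of \<open>E\<close> and \<open>R\<close>
  (\<open>imaginary_chain_kernel\<close>, \<open>infinite_chain_kernel\<close>), so every unstable pencil has one
  (\<open>unstable_common_kernel\<close>).

  \<^emph>\<open>The price of a kernel vector.\<close>  Let \<open>P = I - uu\<^sup>T\<close>.  The Frobenius norm splits as
  \<open>|X|\<^sup>2 = |Xu|\<^sup>2 + |X\<^sup>Tu|\<^sup>2 - (u\<bullet>Xu)\<^sup>2 + |PXP|\<^sup>2\<close> (\<open>frobenius_split\<close>).  If \<open>Y + X\<close> and its transpose kill \<open>u\<close>, then the first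
  three terms depend on \<open>Y\<close> alone, and the last one vanishes for \<open>X = \<Delta>\<^sub>Y\<^sup>u\<close>, because \<open>Y + \<Delta>\<^sub>Y\<^sup>u = PYP\<close>
  (\<open>add_Delta\<close>).  The compression \<open>PYP\<close> inherits semidefiniteness and skewness, and the symmetric and the skew part of a
  perturbation are orthogonal.  Hence the distance to singularity is the minimum over the unit sphere of the
  cost of \<open>u\<close>, and the distance to instability is at least the corresponding minimum without \<open>J\<close>.

  \<^emph>\<open>The second minimum is approached by pencils of index two.\<close>  After the compression of \<open>E\<close> and \<open>R\<close>, add a small multiple of \<open>P\<close>
  to \<open>E\<close>, and a small skew matrix to \<open>J\<close> if \<open>Ju = 0\<close>.  Then \<open>u\<close> spans the
  kernel of the new \<open>E\<close> and \<open>Ju\<close> is nonzero and orthogonal to \<open>u\<close>, so \<open>Ju = Eg\<close> for some \<open>g\<close>: the chain \<open>u, g\<close> spans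
  an infinite block of size two.  It splits off from a deflating subspace on which \<open>E\<close> is injective
  (\<open>index_two_reduction\<close>), and the Jordan form of the matrix of the pencil on that subspace completes a Kronecker form
  (\<open>kronecker_form_of_reduction\<close>).  In dimension one \<open>J = 0\<close> and no skew matrix moves \<open>u\<close>, but then the compressed
  pencil is singular, hence unstable.

  The bounds by eigenvalues hold because the cost of \<open>u\<close> lies between \<open>q\<close> and \<open>2q\<close>, where \<open>q\<close> is the quadratic form
  at \<open>u\<close> of the matrix whose smallest eigenvalue appears, and that eigenvalue is the minimum of the
  form on the sphere (\<open>lambda_min_rayleigh\<close>).
\<close>

text \<open>
  The symbols \<open>$\<close> and \<open>\<bullet>\<close> denote components and inner products of vectors indexed by a finite type, as in
  the definitions above.
\<close>

no_notation Matrix.vec_index (infixl \<open>$\<close> 100)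
no_notation Matrix.scalar_prod (infix \<open>\<bullet>\<close> 70)

section \<open>Real quadratic forms\<close>

lemma inner_matrix_transpose: "x \<bullet> (A *v y) = (transpose A *v x) \<bullet> y"
  for A :: "real^'n^'m"
  by (simp add: dot_lmul_matrix transpose_matrix_vector)

lemma neg_matrix_mult_vec: "(- A) *v x = - (A *v x)" for A :: "real^'n^'m"
  using matrix_vector_mult_diff_rdistrib[of 0 A x] by simp

lemma psd_sym: "psd X \<Longrightarrow> transpose X = X"
  by (simp add: psd_def)

lemma sym_inner_swap: "transpose X = X \<Longrightarrow> x \<bullet> (X *v y) = y \<bullet> (X *v x)" for X :: "real^'n^'n"
  by (metis inner_commute inner_matrix_transpose)

lemma skew_inner_swap: "skew X \<Longrightarrow> x \<bullet> (X *v y) = - (y \<bullet> (X *v x))"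
proof -
  assume "skew X"
  then have "x \<bullet> (X *v y) = ((- X) *v x) \<bullet> y"
    by (simp add: inner_matrix_transpose skew_def)
  then show ?thesis by (simp add: neg_matrix_mult_vec inner_commute)
qed

lemma skew_inner_self: "skew X \<Longrightarrow> x \<bullet> (X *v x) = 0"
  using skew_inner_swap[of X x x] by simp

text \<open>
  The quadratic form at \<open>x + t(Xx)\<close> is \<open>2t|Xx|\<^sup>2 + O(t\<^sup>2)\<close>, which is negative for some small \<open>t < 0\<close> unless \<open>Xx = 0\<close>.
\<close>

lemma psd_kernel:
  assumes X: "psd X" and x: "x \<bullet> (X *v x) = 0"
  shows "X *v x = 0"
proof (rule ccontr)
  assume ne: "X *v x \<noteq> 0"
  define y where "y = X *v x"
  define p where "p = y \<bullet> y"
  define q where "q = y \<bullet> (X *v y)"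
  have p: "p > 0" using ne by (simp add: p_def y_def)
  have q: "q \<ge> 0" using X by (simp add: q_def psd_def)
  have pos: "0 \<le> 2 * t * p + t\<^sup>2 * q" for t
  proof -
    have "0 \<le> (x + t *\<^sub>R y) \<bullet> (X *v (x + t *\<^sub>R y))" using X by (simp add: psd_def)
    also have "\<dots> = x \<bullet> (X *v x) + t * (x \<bullet> (X *v y)) + t * (y \<bullet> (X *v x)) + t\<^sup>2 * (y \<bullet> (X *v y))"
      by (simp add: matrix_vector_right_distrib matrix_vector_mult_scaleR inner_add_left
          inner_add_right power2_eq_square algebra_simps)
    also have "x \<bullet> (X *v y) = p"
      using sym_inner_swap[OF psd_sym[OF X], of x y] by (simp add: p_def y_def)
    also have "y \<bullet> (X *v x) = p" by (simp add: p_def y_def)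
    finally show ?thesis using x by (simp add: q_def algebra_simps)
  qed
  \<comment> \<open>The denominator \<open>q + 1\<close> keeps \<open>t\<close> small enough also when \<open>q = 0\<close>.\<close>
  have "0 \<le> 2 * (- (p / (q + 1))) * p + (- (p / (q + 1)))\<^sup>2 * q" by (rule pos)
  also have "\<dots> = - (p\<^sup>2 * (q + 2) / (q + 1)\<^sup>2)"
    using q by (simp add: power2_eq_square divide_simps) (simp add: algebra_simps)
  also have "\<dots> < 0" using p q by (simp add: add_nonneg_pos)
  finally show False by simp
qed

lemma quadratic_form_normalized:
  fixes X :: "real^'n^'n"
  shows "((1 / norm x) *\<^sub>R x) \<bullet> (X *v ((1 / norm x) *\<^sub>R x)) = (x \<bullet> (X *v x)) / (norm x)\<^sup>2"
  by (simp add: matrix_vector_mult_scaleR power2_eq_square)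

lemma psd_minus_rayleigh_bound:
  fixes X :: "real^'n^'n"
  assumes sym: "transpose X = X" and le: "\<And>u. norm u = 1 \<Longrightarrow> \<mu> \<le> u \<bullet> (X *v u)"
  shows "psd (X - \<mu> *\<^sub>R mat 1)"
proof -
  have "\<mu> * (x \<bullet> x) \<le> x \<bullet> (X *v x)" for x
  proof (cases "x = 0")
    case False
    have "\<mu> \<le> ((1 / norm x) *\<^sub>R x) \<bullet> (X *v ((1 / norm x) *\<^sub>R x))"
      by (rule le) (use False in simp)
    also have "\<dots> = (x \<bullet> (X *v x)) / (norm x)\<^sup>2"
      by (rule quadratic_form_normalized)
    finally show ?thesis using False
      by (simp add: pos_le_divide_eq power2_norm_eq_inner)
  qed simp
  moreover have "transpose (X - \<mu> *\<^sub>R mat 1) = X - \<mu> *\<^sub>R mat 1"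
    using sym by (auto simp: Finite_Cartesian_Product.vec_eq_iff Finite_Cartesian_Product.transpose_def
        Finite_Cartesian_Product.mat_def)
  ultimately show ?thesis
    by (simp add: psd_def matrix_vector_mult_diff_rdistrib inner_diff_right
        scaleR_matrix_vector_assoc[symmetric])
qed

text \<open>
  Eigenvectors of different eigenvalues are orthogonal, hence linearly independent.  Finiteness makes the
  minimum in \<open>lambda_min\<close> meaningful.
\<close>

lemma finite_eigenvalues_symmetric:
  fixes X :: "real^'n^'n"
  assumes sym: "transpose X = X"
  shows "finite {c. \<exists>v. v \<noteq> 0 \<and> X *v v = c *\<^sub>R v}" (is "finite ?S")
proof -
  obtain e where e: "\<And>c. c \<in> ?S \<Longrightarrow> e c \<noteq> 0 \<and> X *v e c = c *\<^sub>R e c"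
    using that[of "\<lambda>c. SOME v. v \<noteq> 0 \<and> X *v v = c *\<^sub>R v"] by (metis (mono_tags, lifting) mem_Collect_eq someI_ex)
  have orth: "e c \<bullet> e d = 0" if "c \<in> ?S" "d \<in> ?S" "c \<noteq> d" for c d
  proof -
    have "d * (e c \<bullet> e d) = c * (e c \<bullet> e d)"
      using sym_inner_swap[OF sym, of "e c" "e d"] e[OF that(1)] e[OF that(2)]
      by (simp add: inner_commute)
    then show ?thesis using that(3) by simp
  qed
  have inj: "inj_on e ?S"
  proof (rule inj_onI, rule ccontr)
    fix c d assume *: "c \<in> ?S" "d \<in> ?S" "e c = e d" "c \<noteq> d"
    then have "e c \<bullet> e c = 0" using orth[of c d] by simp
    then show False using e[OF *(1)] by simp
  qed
  have "pairwise real_inner_class.orthogonal (e ` ?S)"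
    unfolding pairwise_def real_inner_class.orthogonal_def using orth by blast
  moreover have "0 \<notin> e ` ?S" using e by force
  ultimately have "finite (e ` ?S)"
    using pairwise_orthogonal_independent independent_bound by blast
  then show ?thesis using inj by (rule finite_imageD)
qed

lemma continuous_on_matrix_vector_mult [continuous_intros]:
  fixes A :: "real^'n^'m"
  shows "continuous_on S f \<Longrightarrow> continuous_on S (\<lambda>x. A *v f x)"
  by (rule bounded_linear.continuous_on[OF matrix_vector_mul_bounded_linear])

lemma sphere_attains_min:
  fixes f :: "real^'n \<Rightarrow> real"
  assumes "continuous_on (sphere 0 1) f"
  obtains u where "norm u = 1" "\<And>v. norm v = 1 \<Longrightarrow> f u \<le> f v"
proof -
  have "axis undefined 1 \<in> (sphere 0 1 :: (real^'n) set)" by simp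
  then have "sphere 0 1 \<noteq> ({} :: (real^'n) set)" by blast
  from continuous_attains_inf[OF compact_sphere this assms] show thesis
    using that by auto
qed

text \<open>
  If \<open>\<mu>\<close> is the minimum of the quadratic form on the sphere, then \<open>X - \<mu>I\<close> is positive semidefinite and its form
  vanishes at a minimizer, which is therefore an eigenvector by \<open>psd_kernel\<close>.
\<close>

lemma lambda_min_rayleigh:
  fixes X :: "real^'n^'n"
  assumes sym: "transpose X = X"
  obtains u where "norm u = 1" "u \<bullet> (X *v u) = lambda_min X"
    "\<And>v. norm v = 1 \<Longrightarrow> lambda_min X \<le> v \<bullet> (X *v v)"
proof -
  let ?S = "{c. \<exists>v. v \<noteq> 0 \<and> X *v v = c *\<^sub>R v}"
  have "continuous_on (sphere 0 1) (\<lambda>u. u \<bullet> (X *v u))"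
    by (intro continuous_intros)
  then obtain u where u: "norm u = 1" and le: "\<And>v. norm v = 1 \<Longrightarrow> u \<bullet> (X *v u) \<le> v \<bullet> (X *v v)"
    using sphere_attains_min by metis
  define \<mu> where "\<mu> = u \<bullet> (X *v u)"
  have uu: "u \<bullet> u = 1" using u by (simp add: norm_eq_1)
  have Z: "(X - \<mu> *\<^sub>R mat 1) *v x = X *v x - \<mu> *\<^sub>R x" for x
    by (simp add: matrix_vector_mult_diff_rdistrib scaleR_matrix_vector_assoc[symmetric])
  have "(X - \<mu> *\<^sub>R mat 1) *v u = 0"
    by (rule psd_kernel[OF psd_minus_rayleigh_bound[OF sym]])
      (use le uu in \<open>simp_all add: \<mu>_def Z[unfolded \<mu>_def] inner_diff_right\<close>)
  then have "X *v u = \<mu> *\<^sub>R u" by (simp add: Z)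
  moreover have "u \<noteq> 0" using u by auto
  ultimately have in_S: "\<mu> \<in> ?S" by (intro CollectI exI[of _ u] conjI)
  have "\<mu> \<le> c" if "c \<in> ?S" for c
  proof -
    from that obtain v where v: "v \<noteq> 0" "X *v v = c *\<^sub>R v" by (elim CollectE exE conjE)
    have "\<mu> \<le> ((1 / norm v) *\<^sub>R v) \<bullet> (X *v ((1 / norm v) *\<^sub>R v))"
      unfolding \<mu>_def by (rule le) (use v(1) in simp)
    also have "\<dots> = (v \<bullet> (X *v v)) / (norm v)\<^sup>2" by (rule quadratic_form_normalized)
    also have "v \<bullet> (X *v v) = c * (norm v)\<^sup>2"
      by (simp only: v(2) inner_scaleR_right power2_norm_eq_inner)
    also have "c * (norm v)\<^sup>2 / (norm v)\<^sup>2 = c" using v(1) by simp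
    finally show ?thesis .
  qed
  then have "lambda_min X = \<mu>"
    unfolding lambda_min_def
    by (intro Min_eqI finite_eigenvalues_symmetric[OF sym] in_S)
  then show thesis using that u le by (simp add: \<mu>_def)
qed

section \<open>Compressions and the Frobenius norm\<close>

lemma outer_mult_vec: "outer u *v x = (u \<bullet> x) *\<^sub>R u"
  by (simp add: Finite_Cartesian_Product.vec_eq_iff outer_def matrix_vector_mult_def inner_vec_def sum_distrib_left mult_ac)

lemma proj_mult_vec: "(mat 1 - outer u) *v x = x - (u \<bullet> x) *\<^sub>R u"
  by (simp add: matrix_vector_mult_diff_rdistrib outer_mult_vec)

lemma transpose_diff: "transpose (A - B) = transpose A - transpose B"
  for A B :: "real^'n^'m"
  by (simp add: Finite_Cartesian_Product.vec_eq_iff Finite_Cartesian_Product.transpose_def)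

lemma transpose_add: "transpose (A + B) = transpose A + transpose B"
  for A B :: "real^'n^'m"
  by (simp add: Finite_Cartesian_Product.vec_eq_iff Finite_Cartesian_Product.transpose_def)

lemma transpose_proj: "transpose (mat 1 - outer u) = mat 1 - outer u"
  by (auto simp: Finite_Cartesian_Product.vec_eq_iff Finite_Cartesian_Product.transpose_def
        Finite_Cartesian_Product.mat_def outer_def)

lemma norm_proj_sq:
  assumes "norm u = 1"
  shows "(norm (x - (u \<bullet> x) *\<^sub>R u))\<^sup>2 = (norm x)\<^sup>2 - (u \<bullet> x)\<^sup>2"
proof -
  have "u \<bullet> u = 1" using assms by (simp add: norm_eq_1)
  then show ?thesis
    by (simp add: power2_norm_eq_inner inner_diff_left inner_diff_right inner_commute)
      (simp add: power2_eq_square)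
qed

lemma norm_matrix_sq: "(norm X)\<^sup>2 = (\<Sum>i\<in>UNIV. (norm (X $ i))\<^sup>2)" for X :: "real^'n^'m"
  by (simp add: norm_vec_def L2_set_def sum_nonneg)

lemma inner_transpose: "transpose X \<bullet> transpose Y = X \<bullet> Y" for X Y :: "real^'n^'m"
  unfolding inner_vec_def Finite_Cartesian_Product.transpose_def by (simp add: inner_real_def) (rule sum.swap)

lemma norm_transpose: "norm (transpose X) = norm X" for X :: "real^'n^'m"
  by (simp add: norm_eq_sqrt_inner inner_transpose)

text \<open>
  Each row of \<open>X\<close> splits orthogonally into its component along \<open>u\<close>, whose length is an entry of \<open>Xu\<close>, and
  its projection to the complement of \<open>u\<close>.
\<close>

lemma frobenius_split_right:
  fixes X :: "real^'n^'m"
  assumes u: "norm u = 1"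
  shows "(norm X)\<^sup>2 = (norm (X *v u))\<^sup>2 + (norm (X ** (mat 1 - outer u)))\<^sup>2"
proof -
  have Xu: "(X *v u) $ i = u \<bullet> X $ i" for i
    by (simp add: matrix_vector_mul_component inner_commute)
  have row: "(X ** (mat 1 - outer u)) $ i = X $ i - (u \<bullet> X $ i) *\<^sub>R u" for i
  proof -
    have "(X ** (mat 1 - outer u)) $ i = (mat 1 - outer u) *v X $ i"
      by (subst transpose_proj[symmetric])
        (simp add: Finite_Cartesian_Product.vec_eq_iff matrix_matrix_mult_def matrix_vector_mult_def
          Finite_Cartesian_Product.transpose_def mult.commute)
    then show ?thesis by (simp add: proj_mult_vec)
  qed
  have "(norm (X *v u))\<^sup>2 = (\<Sum>i\<in>UNIV. (u \<bullet> X $ i)\<^sup>2)"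
    by (simp add: norm_vec_def L2_set_def sum_nonneg Xu)
  then show ?thesis
    by (simp add: norm_matrix_sq[of X] norm_matrix_sq[of "X ** _"] row norm_proj_sq[OF u]
        sum_subtractf)
qed

definition compress :: "real^'n \<Rightarrow> real^'n^'n \<Rightarrow> real^'n^'n" where
  "compress u X = (mat 1 - outer u) ** X ** (mat 1 - outer u)"

lemma compress_mult_vec:
  "compress u X *v x = (mat 1 - outer u) *v (X *v ((mat 1 - outer u) *v x))"
  by (simp add: compress_def matrix_vector_mul_assoc matrix_mul_assoc)

lemma transpose_compress: "transpose (compress u X) = compress u (transpose X)"
  by (simp add: compress_def matrix_transpose_mul transpose_proj matrix_mul_assoc)

text \<open>
  Splitting rows and then columns counts \<open>u\<bullet>Xu\<close> in both \<open>Xu\<close> and \<open>X\<^sup>Tu\<close>, whence the subtracted term.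
\<close>

lemma frobenius_split:
  fixes X :: "real^'n^'n"
  assumes u: "norm u = 1"
  shows "(norm X)\<^sup>2 = (norm (X *v u))\<^sup>2 + (norm (transpose X *v u))\<^sup>2 - (u \<bullet> (X *v u))\<^sup>2
    + (norm (compress u X))\<^sup>2"
proof -
  let ?P = "mat 1 - outer u"
  have "(norm (X ** ?P))\<^sup>2 = (norm (?P ** transpose X))\<^sup>2"
    by (subst norm_transpose[symmetric]) (simp add: matrix_transpose_mul transpose_proj)
  also have "\<dots> = (norm (?P *v (transpose X *v u)))\<^sup>2 + (norm (compress u (transpose X)))\<^sup>2"
    by (subst frobenius_split_right[OF u]) (simp add: compress_def matrix_vector_mul_assoc del: transpose_matrix_vector)
  also have "(norm (?P *v (transpose X *v u)))\<^sup>2 = (norm (transpose X *v u))\<^sup>2 - (u \<bullet> (X *v u))\<^sup>2"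
    by (simp add: proj_mult_vec norm_proj_sq[OF u])
      (simp add: inner_matrix_transpose[of u X u] inner_commute)
  also have "norm (compress u (transpose X)) = norm (compress u X)"
    by (metis transpose_compress norm_transpose)
  finally show ?thesis using frobenius_split_right[OF u, of X] by simp
qed

lemma add_Delta:
  fixes Y :: "real^'n^'n"
  shows "Y + Delta u Y = compress u Y"
proof (subst matrix_eq, intro allI)
  fix x :: "real^'n"
  show "(Y + Delta u Y) *v x = compress u Y *v x"
    by (simp add: compress_mult_vec Delta_def matrix_vector_mult_add_rdistrib
        matrix_vector_mult_diff_rdistrib neg_matrix_mult_vec matrix_vector_mul_assoc[symmetric] outer_mult_vec
        matrix_vector_right_distrib matrix_vector_mult_diff_distrib matrix_vector_mult_scaleR
        inner_diff_right algebra_simps)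
qed

lemma compress_kernel: "norm u = 1 \<Longrightarrow> compress u X *v u = 0"
  by (simp add: compress_mult_vec proj_mult_vec norm_eq_1)

lemma Delta_eq: "Delta u Y = compress u Y - Y"
  using add_Delta[of Y u] by (simp add: algebra_simps)

lemma compress_compress: "norm u = 1 \<Longrightarrow> compress u (compress u X) = compress u X"
  by (subst matrix_eq)
    (simp add: compress_mult_vec proj_mult_vec norm_eq_1 inner_diff_right)

lemma compress_diff: "compress u (X - Y) = compress u X - compress u Y"
  by (subst matrix_eq)
    (simp add: compress_mult_vec matrix_vector_mult_diff_rdistrib matrix_vector_mult_diff_distrib)

text \<open>
  Since \<open>\<Delta>\<^sub>Y\<^sup>u\<close> is a compression minus \<open>Y\<close>, its own compression is zero, and its action on \<open>u\<close> is that of \<open>-Y\<close>.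
\<close>

lemma norm_Delta_sq:
  assumes u: "norm u = 1"
  shows "(norm (Delta u Y))\<^sup>2 =
    (norm (Y *v u))\<^sup>2 + (norm (transpose Y *v u))\<^sup>2 - (u \<bullet> (Y *v u))\<^sup>2"
  by (subst frobenius_split[OF u])
    (simp add: Delta_eq compress_diff compress_compress[OF u] matrix_vector_mult_diff_rdistrib
      compress_kernel[OF u] transpose_diff transpose_compress)

text \<open>
  Here \<open>X\<close> ranges over the perturbations after which \<open>u\<close> lies in the left and right kernel; by \<open>norm_Delta_sq\<close>
  the bound is attained by \<open>\<Delta>\<^sub>Y\<^sup>u\<close>.
\<close>

lemma norm_ge_deflation:
  fixes X Y :: "real^'n^'n"
  assumes u: "norm u = 1" and "(Y + X) *v u = 0" "transpose (Y + X) *v u = 0"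
  shows "(norm (Y *v u))\<^sup>2 + (norm (transpose Y *v u))\<^sup>2 - (u \<bullet> (Y *v u))\<^sup>2 \<le> (norm X)\<^sup>2"
proof -
  have "X *v u = - (Y *v u)" "transpose X *v u = - (transpose Y *v u)"
    using assms(2,3) unfolding transpose_add matrix_vector_mult_add_rdistrib
    by (simp_all only: add_eq_0_iff)
  then show ?thesis by (simp add: frobenius_split[OF u, of X])
qed

lemma psd_compress: "psd X \<Longrightarrow> psd (compress u X)"
  unfolding psd_def
  by (simp add: transpose_compress compress_mult_vec
      inner_matrix_transpose[of _ "mat 1 - outer u"] transpose_proj)

lemma skew_compress: "skew X \<Longrightarrow> skew (compress u X)"
proof -
  assume "skew X"
  moreover have "compress u (- X) = - compress u X"
    using compress_diff[of u 0 X] compress_diff[of u 0 0] by simp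
  ultimately show ?thesis by (simp add: skew_def transpose_compress)
qed

lemma skew_sym_orthogonal:
  assumes "transpose S = S" "skew K"
  shows "K \<bullet> S = 0"
  using inner_transpose[of K S] assms by (simp add: skew_def)

section \<open>Complex kernel vectors of real pencils\<close>

definition re_vec :: "complex^'n \<Rightarrow> real^'n" where "re_vec v = (\<chi> i. Re (v $ i))"
definition im_vec :: "complex^'n \<Rightarrow> real^'n" where "im_vec v = (\<chi> i. Im (v $ i))"

lemma re_im_vec_simps [simp]:
  "re_vec (complexify M *v v) = M *v re_vec v" "im_vec (complexify M *v v) = M *v im_vec v"
  "re_vec (z *s v) = Re z *\<^sub>R re_vec v - Im z *\<^sub>R im_vec v"
  "im_vec (z *s v) = Re z *\<^sub>R im_vec v + Im z *\<^sub>R re_vec v"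
  "re_vec (v + w) = re_vec v + re_vec w" "im_vec (v + w) = im_vec v + im_vec w"
  "re_vec 0 = 0" "im_vec 0 = 0"
  by (simp_all add: re_vec_def im_vec_def Finite_Cartesian_Product.vec_eq_iff matrix_vector_mult_def)

lemma re_im_vec_eq_0: "re_vec v = 0 \<Longrightarrow> im_vec v = 0 \<Longrightarrow> v = 0"
  by (simp add: re_vec_def im_vec_def Finite_Cartesian_Product.vec_eq_iff complex_eq_iff)

lemma pencil_at_mult_vec:
  "pencil_at L z *v v = z *s (complexify (fst L) *v v) - complexify (snd L) *v v"
  by (simp add: pencil_at_def Finite_Cartesian_Product.vec_eq_iff matrix_vector_mult_def
      sum_subtractf[symmetric] sum_distrib_left algebra_simps)

lemma det_eq_0_iff_kernel: "det M = 0 \<longleftrightarrow> (\<exists>v. v \<noteq> 0 \<and> M *v v = 0)" for M :: "'a::field^'n^'n"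
  using invertible_det_nz[of M] invertible_left_inverse[of M] matrix_left_invertible_ker[of M]
  by auto

lemma det_pencil_at_eq_0:
  "det (pencil_at L z) = 0 \<longleftrightarrow>
    (\<exists>v. v \<noteq> 0 \<and> complexify (snd L) *v v = z *s (complexify (fst L) *v v))"
  by (auto simp: det_eq_0_iff_kernel pencil_at_mult_vec)

text \<open>
  The real part of the inner product of the eigenvalue equation with \<open>v\<close>; skewness of \<open>J\<close> and symmetry of \<open>E\<close> cancel the other
  contributions.
\<close>

lemma eigenvector_energy:
  fixes E J R :: "real^'n^'n"
  assumes E: "psd E" and R: "psd R" and J: "skew J"
    and v: "complexify (J - R) *v v = z *s (complexify E *v v)"
  defines "a \<equiv> re_vec v" and "b \<equiv> im_vec v"
  shows "Re z * (a \<bullet> (E *v a) + b \<bullet> (E *v b)) + (a \<bullet> (R *v a) + b \<bullet> (R *v b)) = 0"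
proof -
  have 1: "J *v a - R *v a = Re z *\<^sub>R (E *v a) - Im z *\<^sub>R (E *v b)"
    using arg_cong[OF v, of re_vec] by (simp add: a_def b_def matrix_vector_mult_diff_rdistrib)
  have 2: "J *v b - R *v b = Re z *\<^sub>R (E *v b) + Im z *\<^sub>R (E *v a)"
    using arg_cong[OF v, of im_vec] by (simp add: a_def b_def matrix_vector_mult_diff_rdistrib)
  have "- (a \<bullet> (R *v a)) = Re z * (a \<bullet> (E *v a)) - Im z * (a \<bullet> (E *v b))"
    using arg_cong[OF 1, of "inner a"] by (simp add: inner_diff_right skew_inner_self[OF J])
  moreover have "- (b \<bullet> (R *v b)) = Re z * (b \<bullet> (E *v b)) + Im z * (a \<bullet> (E *v b))"
    using arg_cong[OF 2, of "inner b"] sym_inner_swap[OF psd_sym[OF E], of b a]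
    by (simp add: inner_diff_right inner_add_right skew_inner_self[OF J])
  ultimately show ?thesis by (simp add: algebra_simps)
qed

lemma unit_kernel_vector:
  fixes w :: "real^'n"
  assumes "w \<noteq> 0" "E *v w = 0" "R *v w = 0" "J *v w = 0"
  shows "\<exists>u. norm u = 1 \<and> E *v u = 0 \<and> R *v u = 0 \<and> J *v u = 0"
  using assms by (intro exI[of _ "(1 / norm w) *\<^sub>R w"]) (simp add: matrix_vector_mult_scaleR)

lemma right_half_plane_eigenvalue:
  assumes E: "psd E" and R: "psd R" and J: "skew J"
    and z: "0 < Re z" "finite_eigenvalue (E, J - R) z"
  shows "\<exists>u. norm u = 1 \<and> E *v u = 0 \<and> R *v u = 0 \<and> J *v u = 0"
proof -
  obtain v where v: "v \<noteq> 0" "complexify (J - R) *v v = z *s (complexify E *v v)"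
    using z(2) by (auto simp: finite_eigenvalue_def det_pencil_at_eq_0)
  let ?a = "re_vec v" and ?b = "im_vec v"
  have nn: "0 \<le> x \<bullet> (E *v x)" "0 \<le> x \<bullet> (R *v x)" for x using E R by (simp_all add: psd_def)
  have s: "0 \<le> Re z * (?a \<bullet> (E *v ?a) + ?b \<bullet> (E *v ?b))" using z(1) nn by simp
  have "?a \<bullet> (R *v ?a) = 0" "?b \<bullet> (R *v ?b) = 0"
    "Re z * (?a \<bullet> (E *v ?a) + ?b \<bullet> (E *v ?b)) = 0"
    using eigenvector_energy[OF E R J v(2)] s nn(2)[of ?a] nn(2)[of ?b] by linarith+
  moreover from this(3) have "?a \<bullet> (E *v ?a) = 0" "?b \<bullet> (E *v ?b) = 0"
    using z(1) nn(1)[of ?a] nn(1)[of ?b] by (auto simp: add_nonneg_eq_0_iff)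
  ultimately have k: "E *v ?a = 0" "E *v ?b = 0" "R *v ?a = 0" "R *v ?b = 0"
    using psd_kernel[OF E] psd_kernel[OF R] by auto
  have "J *v ?a = 0" "J *v ?b = 0"
    using arg_cong[OF v(2), of re_vec] arg_cong[OF v(2), of im_vec] k
    by (simp_all add: matrix_vector_mult_diff_rdistrib)
  moreover have "?a \<noteq> 0 \<or> ?b \<noteq> 0" using v(1) re_im_vec_eq_0 by blast
  ultimately show ?thesis
    using unit_kernel_vector[of ?a E R J] unit_kernel_vector[of ?b E R J] k by blast
qed

text \<open>
  A singular pencil has every number as an eigenvalue, in particular one in the open right half plane.
\<close>

lemma singular_iff_common_kernel:
  fixes E J R :: "real^'n^'n"
  assumes E: "psd E" and R: "psd R" and J: "skew J"
  shows "singular_pencil (E, J - R) \<longleftrightarrow>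
    (\<exists>u. norm u = 1 \<and> E *v u = 0 \<and> R *v u = 0 \<and> J *v u = 0)"
proof
  assume "singular_pencil (E, J - R)"
  then have "finite_eigenvalue (E, J - R) 1"
    unfolding singular_pencil_def finite_eigenvalue_def by (rule spec)
  then show "\<exists>u. norm u = 1 \<and> E *v u = 0 \<and> R *v u = 0 \<and> J *v u = 0"
    using right_half_plane_eigenvalue[OF E R J, of 1] by simp
next
  assume "\<exists>u. norm u = 1 \<and> E *v u = 0 \<and> R *v u = 0 \<and> J *v u = 0"
  then obtain u where u: "norm u = 1" "E *v u = 0" "R *v u = 0" "J *v u = 0" by blast
  define v where "v = (\<chi> i. complex_of_real (u $ i))"
  have vv: "re_vec v = u" "im_vec v = 0"
    by (simp_all add: v_def re_vec_def im_vec_def Finite_Cartesian_Product.vec_eq_iff)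
  have "complexify M *v v = 0" if "M *v u = 0" for M :: "real^'n^'n"
    by (rule re_im_vec_eq_0) (simp_all add: vv that)
  moreover have "(J - R) *v u = 0" using u by (simp add: matrix_vector_mult_diff_rdistrib)
  moreover have "v \<noteq> 0" using vv(1) u(1) by auto
  ultimately have "det (pencil_at (E, J - R) z) = 0" for z
    unfolding det_pencil_at_eq_0 using u by (intro exI[of _ v]) simp
  then show "singular_pencil (E, J - R)" by (simp add: singular_pencil_def)
qed

text \<open>
  For imaginary \<open>z\<close> the energy identity gives \<open>Rv = 0\<close>, so \<open>v\<close> is also a left eigenvector.  Pairing it with the
  equation for \<open>w\<close> leaves only the energy of \<open>v\<close> with respect to \<open>E\<close>, which must be zero: eigenvalues on the imaginary axis
  are semisimple unless \<open>E\<close> and \<open>R\<close> have a common kernel vector.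
\<close>

lemma imaginary_chain_kernel:
  assumes E: "psd E" and R: "psd R" and J: "skew J" and z: "Re z = 0"
    and v: "complexify (J - R) *v v = z *s (complexify E *v v)"
    and w: "complexify (J - R) *v w = z *s (complexify E *v w) + complexify E *v v"
  shows "E *v re_vec v = 0" "E *v im_vec v = 0" "R *v re_vec v = 0" "R *v im_vec v = 0"
proof -
  let ?a = "re_vec v" and ?b = "im_vec v" and ?c = "re_vec w" and ?d = "im_vec w"
  have nn: "0 \<le> x \<bullet> (E *v x)" "0 \<le> x \<bullet> (R *v x)" for x using E R by (simp_all add: psd_def)
  have "?a \<bullet> (R *v ?a) = 0" "?b \<bullet> (R *v ?b) = 0"
    using eigenvector_energy[OF E R J v] z nn(2)[of ?a] nn(2)[of ?b] by auto
  then show R0: "R *v ?a = 0" "R *v ?b = 0" using psd_kernel[OF R] by auto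
  have Ja: "J *v ?a = - (Im z *\<^sub>R (E *v ?b))"
    using arg_cong[OF v, of re_vec] z R0 by (simp add: matrix_vector_mult_diff_rdistrib)
  have Jb: "J *v ?b = Im z *\<^sub>R (E *v ?a)"
    using arg_cong[OF v, of im_vec] z R0 by (simp add: matrix_vector_mult_diff_rdistrib)
  have c: "J *v ?c - R *v ?c = E *v ?a - Im z *\<^sub>R (E *v ?d)"
    using arg_cong[OF w, of re_vec] z by (simp add: matrix_vector_mult_diff_rdistrib)
  have d: "J *v ?d - R *v ?d = Im z *\<^sub>R (E *v ?c) + E *v ?b"
    using arg_cong[OF w, of im_vec] z by (simp add: matrix_vector_mult_diff_rdistrib)
  have "?a \<bullet> (J *v ?c) = Im z * (?c \<bullet> (E *v ?b))" "?b \<bullet> (J *v ?d) = - (Im z * (?d \<bullet> (E *v ?a)))"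
    using skew_inner_swap[OF J, of ?a ?c] skew_inner_swap[OF J, of ?b ?d] by (simp_all add: Ja Jb)
  moreover have "?a \<bullet> (R *v ?c) = 0" "?b \<bullet> (R *v ?d) = 0"
    using sym_inner_swap[OF psd_sym[OF R]] R0 by (metis inner_zero_right)+
  moreover have "?a \<bullet> (E *v ?d) = ?d \<bullet> (E *v ?a)" "?b \<bullet> (E *v ?c) = ?c \<bullet> (E *v ?b)"
    using sym_inner_swap[OF psd_sym[OF E]] by blast+
  ultimately have "?a \<bullet> (E *v ?a) + ?b \<bullet> (E *v ?b) = 0"
    using arg_cong[OF c, of "inner ?a"] arg_cong[OF d, of "inner ?b"]
    by (simp add: inner_diff_right inner_add_right)
  then have "?a \<bullet> (E *v ?a) = 0" "?b \<bullet> (E *v ?b) = 0" using nn(1)[of ?a] nn(1)[of ?b] by auto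
  then show "E *v ?a = 0" "E *v ?b = 0" using psd_kernel[OF E] by auto
qed

text \<open>
  Pairing \<open>(J - R)v = Ew\<close> with \<open>v\<close> gives zero on the right because \<open>Ev = 0\<close>, and on the left only \<open>R\<close> contributes.
\<close>

lemma infinite_chain_kernel:
  assumes E: "psd E" and R: "psd R" and J: "skew J"
    and v: "complexify E *v v = 0" "complexify (J - R) *v v = complexify E *v w"
  shows "E *v re_vec v = 0" "E *v im_vec v = 0" "R *v re_vec v = 0" "R *v im_vec v = 0"
proof -
  show E0: "E *v re_vec v = 0" "E *v im_vec v = 0"
    using arg_cong[OF v(1), of re_vec] arg_cong[OF v(1), of im_vec] by simp_all
  have *: "R *v x = 0" if "E *v x = 0" "J *v x - R *v x = E *v y" for x y
  proof -
    have "x \<bullet> (E *v y) = 0" using sym_inner_swap[OF psd_sym[OF E], of x y] that by simp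
    then show ?thesis
      using arg_cong[OF that(2), of "inner x"] psd_kernel[OF R, of x]
      by (simp add: inner_diff_right skew_inner_self[OF J])
  qed
  have "J *v re_vec v - R *v re_vec v = E *v re_vec w" "J *v im_vec v - R *v im_vec v = E *v im_vec w"
    using arg_cong[OF v(2), of re_vec] arg_cong[OF v(2), of im_vec]
    by (simp_all add: matrix_vector_mult_diff_rdistrib)
  then show "R *v re_vec v = 0" "R *v im_vec v = 0" using * E0 by blast+
qed

section \<open>Jordan chains of Kronecker blocks\<close>

text \<open>
  A column that meets the diagonal block \<open>A\<close> is zero outside the rows of \<open>A\<close>.
\<close>

lemma diag_block_mat_column:
  fixes A :: "'a::zero mat"
  assumes i: "i < dim_row (diag_block_mat (As @ A # Bs))" and j: "j < dim_col A"
  shows "diag_block_mat (As @ A # Bs) $$ (i, sum_list (map dim_col As) + j)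
    = (if sum_list (map dim_row As) \<le> i \<and> i < sum_list (map dim_row As) + dim_row A
       then A $$ (i - sum_list (map dim_row As), j) else 0)"
  using i
proof (induction As arbitrary: i)
  case Nil
  then show ?case using j by (auto simp: Let_def dim_diag_block_mat)
next
  case (Cons X Xs)
  let ?D = "diag_block_mat (Xs @ A # Bs)"
  have c: "sum_list (map dim_col Xs) + j < dim_col ?D"
    using j by (simp add: dim_diag_block_mat)
  show ?case
  proof (cases "i < dim_row X")
    case True
    then show ?thesis using c by (auto simp: Let_def)
  next
    case False
    then have "i - dim_row X < dim_row ?D" using Cons.prems by (simp add: Let_def)
    from Cons.IH[OF this] False Cons.prems c show ?thesis
      by (auto simp: Let_def less_diff_conv2 le_diff_conv2 add_ac diff_diff_left)
  qed
qed

lemma block_dims: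
  "dim_row (block_A b) = dim_row (block_E b)" "dim_col (block_A b) = dim_col (block_E b)"
  by (cases b; simp)+

text \<open>
  The passage from matrices with explicit dimensions to matrices indexed by a finite type,
  along a numbering \<open>f\<close> of that type.
\<close>

definition to_vec_mat :: "('n::finite \<Rightarrow> nat) \<Rightarrow> 'a mat \<Rightarrow> 'a^'n^'n" where
  "to_vec_mat f M = (\<chi> i j. M $$ (f i, f j))"

lemma to_vec_mat_nth [simp]: "to_vec_mat f M $ i $ j = M $$ (f i, f j)"
  by (simp add: to_vec_mat_def)

lemma to_vec_mat_mult:
  fixes f :: "'n::finite \<Rightarrow> nat" and M N :: "'a::semiring_1 mat"
  assumes f: "bij_betw f UNIV {..<CARD('n)}"
    and "M \<in> carrier_mat CARD('n) CARD('n)" "N \<in> carrier_mat CARD('n) CARD('n)"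
  shows "to_vec_mat f (M * N) = to_vec_mat f M ** to_vec_mat f N"
proof -
  have lt: "f i < CARD('n)" for i using f by (auto simp: bij_betw_def)
  have "(\<Sum>k<CARD('n). M $$ (f i, k) * N $$ (k, f j)) = (\<Sum>k\<in>UNIV. M $$ (f i, f k) * N $$ (f k, f j))" for i j
    by (rule sum.reindex_bij_betw[OF f, symmetric])
  then show ?thesis using assms lt
    by (simp add: Finite_Cartesian_Product.vec_eq_iff matrix_matrix_mult_def Matrix.scalar_prod_def atLeast0LessThan)
qed

lemma to_vec_mat_one:
  fixes f :: "'n::finite \<Rightarrow> nat"
  assumes f: "bij_betw f UNIV {..<CARD('n)}"
  shows "to_vec_mat f (1\<^sub>m CARD('n)) = (mat 1 :: 'a::semiring_1^'n^'n)"
proof -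
  have "f i < CARD('n)" "(f i = f j) = (i = j)" for i j
    using f by (auto simp: bij_betw_def inj_on_def)
  then show ?thesis by (simp add: Finite_Cartesian_Product.vec_eq_iff Finite_Cartesian_Product.mat_def)
qed

lemma complexify_mult: "complexify (A ** B) = complexify A ** complexify B"
  by (simp add: Finite_Cartesian_Product.vec_eq_iff matrix_matrix_mult_def)

lemma complexify_mat1: "complexify (mat 1) = mat 1"
  by (simp add: Finite_Cartesian_Product.vec_eq_iff Finite_Cartesian_Product.mat_def)

lemma complexify_invertible:
  assumes "invertible X" shows "invertible (complexify X)"
  using assms unfolding invertible_def by (metis complexify_mult complexify_mat1)

lemma kronecker_block_bound:
  fixes L :: "'n::finite pencil"
  assumes "kronecker_form L bs" "b \<in> set bs"
  shows "dim_row (block_E b) \<le> CARD('n)"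
proof -
  have "dim_row (diag_block_mat (map block_E bs)) = CARD('n)"
    using assms(1) by (auto simp: kronecker_form_def Let_def)
  moreover have "dim_row (block_E b) \<le> sum_list (map (dim_row \<circ> block_E) bs)"
    using assms(2) by (simp add: member_le_sum_list)
  ultimately show ?thesis by (simp add: dim_diag_block_mat)
qed

text \<open>
  Without this, the maximum in \<open>pencil_index\<close> would carry no information.
\<close>

lemma infinite_block_sizes_finite:
  fixes L :: "'n::finite pencil"
  shows "finite {k. \<exists>bs. kronecker_form L bs \<and> Infinite k \<in> set bs}"
proof -
  have "{k. \<exists>bs. kronecker_form L bs \<and> Infinite k \<in> set bs} \<subseteq> {..CARD('n)}"
    using kronecker_block_bound by fastforce
  then show ?thesis using finite_subset by blast
qed

lemma finite_block_sizes_finite: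
  fixes L :: "'n::finite pencil"
  shows "finite {k. \<exists>bs. kronecker_form L bs \<and> Finite z k \<in> set bs}"
proof -
  have "{k. \<exists>bs. kronecker_form L bs \<and> Finite z k \<in> set bs} \<subseteq> {..CARD('n)}"
    using kronecker_block_bound by fastforce
  then show ?thesis using finite_subset by blast
qed

text \<open>
  A square Kronecker block describes the action of the pencil on the corresponding columns \<open>x\<close> of \<open>Q\<close>, in terms of the
  corresponding columns \<open>y\<close> of the inverse of \<open>P\<close>.
\<close>

lemma kronecker_block_columns:
  fixes L :: "'n::finite pencil"
  assumes kf: "kronecker_form L bs" and b: "b \<in> set bs"
    and sq: "dim_row (block_E b) = k" "dim_col (block_E b) = k"
  obtains x y :: "nat \<Rightarrow> complex^'n" where
    "\<And>j. j < k \<Longrightarrow> complexify (fst L) *v x j = (\<Sum>i<k. block_E b $$ (i, j) *s y i)"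
    "\<And>j. j < k \<Longrightarrow> complexify (snd L) *v x j = (\<Sum>i<k. block_A b $$ (i, j) *s y i)"
    "\<And>j. j < k \<Longrightarrow> x j \<noteq> 0"
proof -
  define KE where "KE = diag_block_mat (map block_E bs)"
  define KA where "KA = diag_block_mat (map block_A bs)"
  obtain P Q :: "complex^'n^'n" and f :: "'n \<Rightarrow> nat" where
    P: "invertible P" and Q: "invertible Q" and f: "bij_betw f UNIV {..<CARD('n)}"
    and E: "P ** complexify (fst L) ** Q = to_vec_mat f KE"
    and A: "P ** complexify (snd L) ** Q = to_vec_mat f KA"
    and dKE: "KE \<in> carrier_mat CARD('n) CARD('n)" and dKA: "KA \<in> carrier_mat CARD('n) CARD('n)"
    using kf unfolding kronecker_form_def Let_def KE_def KA_def to_vec_mat_def by blast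
  obtain P' where P': "P' ** P = mat 1" using P by (auto simp: invertible_def)
  obtain Q' where Q': "Q' ** Q = mat 1" using Q by (auto simp: invertible_def)
  obtain as cs where bs: "bs = as @ b # cs" using b by (meson split_list)
  define r where "r = sum_list (map (dim_row \<circ> block_E) as)"
  define c where "c = sum_list (map (dim_col \<circ> block_E) as)"
  have rA: "r = sum_list (map (dim_row \<circ> block_A) as)"
    and cA: "c = sum_list (map (dim_col \<circ> block_A) as)"
    by (simp_all add: r_def c_def block_dims comp_def)
  have rk: "r + k \<le> CARD('n)" and ck: "c + k \<le> CARD('n)"
    using dKE sq unfolding KE_def bs r_def c_def carrier_mat_def
    by (auto simp: dim_diag_block_mat)
  have KEc: "KE $$ (i, c + j) = (if r \<le> i \<and> i < r + k then block_E b $$ (i - r, j) else 0)"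
    if "i < CARD('n)" "j < k" for i j
    using diag_block_mat_column[of i "map block_E as" "block_E b" "map block_E cs" j] that dKE sq
    unfolding KE_def bs r_def c_def by simp
  have KAc: "KA $$ (i, c + j) = (if r \<le> i \<and> i < r + k then block_A b $$ (i - r, j) else 0)"
    if "i < CARD('n)" "j < k" for i j
    using diag_block_mat_column[of i "map block_A as" "block_A b" "map block_A cs" j] that dKA sq
    unfolding KA_def bs rA cA by (simp add: block_dims)
  define g where "g = inv_into UNIV f"
  have fg: "f (g m) = m" if "m < CARD('n)" for m
    unfolding g_def using f that by (simp add: bij_betw_def f_inv_into_f)
  have inj: "f i = f j \<longleftrightarrow> i = j" for i j using f by (auto simp: bij_betw_def inj_on_def)
  have flt: "f i < CARD('n)" for i using f by (auto simp: bij_betw_def)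
  define x where "x j = Q *v axis (g (c + j)) 1" for j
  define y where "y i = P' *v axis (g (r + i)) 1" for i
  have key: "M *v x j = (\<Sum>i<k. B $$ (i, j) *s y i)"
    if M: "P ** M ** Q = to_vec_mat f K" and j: "j < k"
      and K: "\<And>i. i < CARD('n) \<Longrightarrow>
        K $$ (i, c + j) = (if r \<le> i \<and> i < r + k then B $$ (i - r, j) else 0)" for M K B j
  proof -
    have "to_vec_mat f K *v axis (g (c + j)) 1 = (\<Sum>i<k. B $$ (i, j) *s axis (g (r + i)) 1)"
    proof (subst Finite_Cartesian_Product.vec_eq_iff, intro allI)
      fix l
      have "(to_vec_mat f K *v axis (g (c + j)) 1) $ l = K $$ (f l, c + j)"
        using fg[of "c + j"] ck j
        by (simp add: matrix_vector_mult_def axis_def if_distrib cong: if_cong)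
      also have "\<dots> = (if r \<le> f l \<and> f l < r + k then B $$ (f l - r, j) else 0)"
        by (rule K[OF flt])
      also have "\<dots> = (\<Sum>i<k. B $$ (i, j) * (if l = g (r + i) then 1 else 0))"
      proof (cases "r \<le> f l \<and> f l < r + k")
        case True
        have "(l = g (r + i)) = (i = f l - r)" if "i < k" for i
          using fg[of "r + i"] rk that inj True by (metis (full_types) add_diff_cancel_left' add_less_cancel_left le_add_diff_inverse order_less_le_trans)
        then have "(\<Sum>i<k. B $$ (i, j) * (if l = g (r + i) then 1 else 0))
            = (\<Sum>i<k. if i = f l - r then B $$ (i, j) else 0)"
          by (intro sum.cong) auto
        then show ?thesis using True by auto
      next
        case False
        have "l \<noteq> g (r + i)" if "i < k" for i
          using fg[of "r + i"] rk that False by auto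
        then show ?thesis using False by auto
      qed
      finally show "(to_vec_mat f K *v axis (g (c + j)) 1) $ l
          = (\<Sum>i<k. B $$ (i, j) *s axis (g (r + i)) 1) $ l"
        by (simp add: axis_def)
    qed
    then have "P' *v ((P ** M ** Q) *v axis (g (c + j)) 1) = (\<Sum>i<k. B $$ (i, j) *s y i)"
      by (simp add: M y_def vec.sum vec.scale)
    then show ?thesis
      unfolding x_def by (simp add: matrix_vector_mul_assoc matrix_mul_assoc P')
  qed
  show thesis
  proof
    show "complexify (fst L) *v x j = (\<Sum>i<k. block_E b $$ (i, j) *s y i)" if "j < k" for j
      using key[OF E that] KEc that by blast
    show "complexify (snd L) *v x j = (\<Sum>i<k. block_A b $$ (i, j) *s y i)" if "j < k" for j
      using key[OF A that] KAc that by blast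
    show "x j \<noteq> 0" for j
    proof
      assume "x j = 0"
      then have "Q' *v x j = 0" by simp
      then show False by (simp add: x_def matrix_vector_mul_assoc Q')
    qed
  qed
qed

lemma sum_delta_scale:
  fixes y :: "nat \<Rightarrow> 'a::semiring_1^'n"
  assumes "j < k"
  shows "(\<Sum>i<k. (if i = j then c else 0) *s y i) = c *s y j"
proof -
  have "(\<Sum>i<k. (if i = j then c else 0) *s y i) = (\<Sum>i<k. if i = j then c *s y i else 0)"
    by (intro sum.cong) auto
  then show ?thesis using assms by simp
qed

lemma infinite_block_chain:
  fixes L :: "'n::finite pencil"
  assumes "2 \<le> pencil_index L"
  obtains v w where "v \<noteq> 0" "complexify (fst L) *v v = 0"
    "complexify (snd L) *v v = complexify (fst L) *v w"
proof -
  let ?S = "{k. \<exists>bs. kronecker_form L bs \<and> Infinite k \<in> set bs}"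
  have "pencil_index L \<in> insert 0 ?S"
    unfolding pencil_index_def by (intro Max_in finite.insertI infinite_block_sizes_finite) simp
  then obtain bs where bs: "kronecker_form L bs" "Infinite (pencil_index L) \<in> set bs"
    using assms by auto
  define k where "k = pencil_index L"
  have k: "2 \<le> k" using assms k_def by simp
  obtain x y where
    E: "\<And>j. j < k \<Longrightarrow> complexify (fst L) *v x j = (\<Sum>i<k. block_E (Infinite k) $$ (i, j) *s y i)" and
    A: "\<And>j. j < k \<Longrightarrow> complexify (snd L) *v x j = (\<Sum>i<k. block_A (Infinite k) $$ (i, j) *s y i)" and
    x: "\<And>j. j < k \<Longrightarrow> x j \<noteq> 0"
    using kronecker_block_columns[OF bs, of k] k_def by auto
  show thesis
  proof
    show "x 0 \<noteq> 0" using x k by simp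
    show "complexify (fst L) *v x 0 = 0"
      using E[of 0] k by (simp add: if_distribR cong: if_cong)
    have "complexify (snd L) *v x 0 = y 0"
      using A[of 0] k sum_delta_scale[of 0 k 1 y] by simp
    moreover have "complexify (fst L) *v x 1 = (\<Sum>i<k. block_E (Infinite k) $$ (i, 1) *s y i)"
      using E[of 1] k by simp
    moreover have "\<dots> = (\<Sum>i<k. (if i = 0 then 1 else 0) *s y i)"
      by (rule sum.cong) (use k in auto)
    moreover have "\<dots> = y 0"
      using k sum_delta_scale[of 0 k 1 y] by simp
    ultimately show "complexify (snd L) *v x 0 = complexify (fst L) *v x 1" by simp
  qed
qed

lemma finite_block_chain:
  fixes L :: "'n::finite pencil"
  assumes "\<not> max_jordan_block L z \<le> 1"
  obtains v w where "v \<noteq> 0" "complexify (snd L) *v v = z *s (complexify (fst L) *v v)"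
    "complexify (snd L) *v w = z *s (complexify (fst L) *v w) + complexify (fst L) *v v"
proof -
  let ?S = "{k. \<exists>bs. kronecker_form L bs \<and> Finite z k \<in> set bs}"
  have "max_jordan_block L z \<in> insert 0 ?S"
    unfolding max_jordan_block_def by (intro Max_in finite.insertI finite_block_sizes_finite) simp
  then obtain bs where bs: "kronecker_form L bs" "Finite z (max_jordan_block L z) \<in> set bs"
    using assms by auto
  define k where "k = max_jordan_block L z"
  have k: "2 \<le> k" using assms k_def by simp
  obtain x y where
    E: "\<And>j. j < k \<Longrightarrow> complexify (fst L) *v x j = (\<Sum>i<k. block_E (Finite z k) $$ (i, j) *s y i)" and
    A: "\<And>j. j < k \<Longrightarrow> complexify (snd L) *v x j = (\<Sum>i<k. block_A (Finite z k) $$ (i, j) *s y i)" and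
    x: "\<And>j. j < k \<Longrightarrow> x j \<noteq> 0"
    using kronecker_block_columns[OF bs, of k] k_def by auto
  have E': "complexify (fst L) *v x j = y j" if "j < k" for j
    using E[OF that] that sum_delta_scale[OF that, of 1 y] by simp
  show thesis
  proof
    show "x 0 \<noteq> 0" using x k by simp
    have "complexify (snd L) *v x 0 = (\<Sum>i<k. block_A (Finite z k) $$ (i, 0) *s y i)"
      using A[of 0] k by simp
    also have "\<dots> = (\<Sum>i<k. (if i = 0 then z else 0) *s y i)"
      by (rule sum.cong) (use k in auto)
    finally have "complexify (snd L) *v x 0 = z *s y 0"
      using k sum_delta_scale[of 0 k z y] by simp
    then show "complexify (snd L) *v x 0 = z *s (complexify (fst L) *v x 0)" using E' k by simp
    have "complexify (snd L) *v x 1 = (\<Sum>i<k. block_A (Finite z k) $$ (i, 1) *s y i)"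
      using A[of 1] k by simp
    also have "\<dots> = (\<Sum>i<k. (if i = 1 then z else 0) *s y i + (if i = 0 then 1 else 0) *s y i)"
      by (rule sum.cong) (use k in auto)
    also have "\<dots> = z *s y 1 + y 0"
      using k sum_delta_scale[of 1 k z y] sum_delta_scale[of 0 k 1 y] by (simp add: sum.distrib)
    finally show "complexify (snd L) *v x 1
        = z *s (complexify (fst L) *v x 1) + complexify (fst L) *v x 0"
      using E' k by simp
  qed
qed

section \<open>Pencils with an infinite block of size two\<close>

text \<open>
  The matrices \<open>diag(J\<^sub>2(0), I)\<close> and \<open>diag(I, C)\<close>, with the block of size two at the indices \<open>a\<close>, \<open>b\<close>.  The
  matrix \<open>C\<close> supplies the entries away from the rows and columns \<open>a\<close>, \<open>b\<close>, which avoids a smaller index type.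
\<close>

definition inf_block_E :: "'n \<Rightarrow> 'n \<Rightarrow> real^'n^'n" where
  "inf_block_E a b = (\<chi> i j. if j = a then 0 else if j = b then (if i = a then 1 else 0)
     else if i = j then 1 else 0)"

definition inf_block_A :: "'n \<Rightarrow> 'n \<Rightarrow> real^'n^'n \<Rightarrow> real^'n^'n" where
  "inf_block_A a b C = (\<chi> i j. if j = a \<or> j = b then (if i = j then 1 else 0)
     else if i = a \<or> i = b then 0 else C $ i $ j)"

lemma matrix_eq_columns: "(\<And>k. column k A = column k B) \<Longrightarrow> A = B"
  by (simp add: Finite_Cartesian_Product.vec_eq_iff Finite_Cartesian_Product.column_def)

lemma column_mult: "column k (A ** B) = A *v column k B"
  by (simp add: Finite_Cartesian_Product.vec_eq_iff Finite_Cartesian_Product.column_def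
      matrix_matrix_mult_def matrix_vector_mult_def)

lemma sum_remove2:
  fixes g :: "'n::finite \<Rightarrow> 'b::ab_group_add"
  assumes "a \<noteq> b"
  shows "(\<Sum>k\<in>UNIV. g k) = g a + g b + (\<Sum>k\<in>- {a, b}. g k)"
proof -
  have "(\<Sum>k\<in>UNIV. g k) = (\<Sum>k\<in>{a, b}. g k) + (\<Sum>k\<in>- {a, b}. g k)"
    by (subst sum.union_disjoint[symmetric]) auto
  then show ?thesis using assms by (simp add: add.assoc)
qed

lemma invertible_iff_columns:
  fixes M :: "real^'n^'n"
  shows "invertible M \<longleftrightarrow>
    (\<forall>c. (\<Sum>k\<in>UNIV. c k *\<^sub>R column k M) = 0 \<longrightarrow> (\<forall>k. c k = 0))"
  by (simp add: invertible_left_inverse matrix_left_invertible_independent_columns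
      scalar_mult_eq_scaleR)

lemma basis_extending_orthogonal_pair:
  fixes u g :: "real^'n"
  assumes "u \<noteq> 0" "g \<noteq> 0" "u \<bullet> g = 0"
  obtains h :: "'n \<Rightarrow> real^'n" and a b where "a \<noteq> b" "h a = u" "h b = g"
    "\<And>c. (\<Sum>k\<in>UNIV. c k *\<^sub>R h k) = 0 \<Longrightarrow> \<forall>k. c k = 0"
proof -
  have ne: "u \<noteq> g" using assms by auto
  have "pairwise real_inner_class.orthogonal {u, g}"
    using assms(3) by (simp add: pairwise_def real_inner_class.orthogonal_def inner_commute)
  then have "independent {u, g}"
    using assms pairwise_orthogonal_independent[of "{u, g}"] by simp
  then obtain B where B: "{u, g} \<subseteq> B" "independent B" "UNIV \<subseteq> span B"
    using maximal_independent_subset_extend[of "{u, g}" UNIV] by auto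
  have fin: "finite B" using independent_bound B(2) by blast
  have "card B = CARD('n)"
    using basis_card_eq_dim[of B UNIV] B by simp
  then obtain h where h: "bij_betw h (UNIV :: 'n set) B"
    using finite_same_card_bij[of "UNIV :: 'n set" B] fin by auto
  obtain a b where ab: "h a = u" "h b = g" using h B(1) by (metis bij_betw_imp_surj_on insert_subset imageE)
  have "\<forall>k. c k = 0" if c: "(\<Sum>k\<in>UNIV. c k *\<^sub>R h k) = 0" for c
  proof -
    have inj: "inv_into UNIV h (h k) = k" for k using h by (simp add: bij_betw_def inv_into_f_f)
    have "(\<Sum>v\<in>B. c (inv_into UNIV h v) *\<^sub>R v) = 0"
      using c by (subst sum.reindex_bij_betw[OF h, symmetric]) (simp add: inj)
    then have "c (inv_into UNIV h v) = 0" if "v \<in> B" for v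
      using independentD[OF B(2) fin order_refl, of "\<lambda>v. c (inv_into UNIV h v)" v] that by blast
    then have "c (inv_into UNIV h (h k)) = 0" for k
      using bij_betwE[OF h] by blast
    then show ?thesis by (simp add: inj)
  qed
  moreover have "a \<noteq> b" using ab ne by auto
  ultimately show thesis using that[of a b h] ab by blast
qed

text \<open>
  Put \<open>w = Au\<close>.  Since \<open>w\<close> is orthogonal to the kernel of \<open>E\<close>, there is \<open>g\<close> with \<open>Eg = w = Au\<close>, and \<open>u, g\<close> is the infinite
  chain.  The rest of a basis is first made orthogonal to \<open>w\<close>, which puts its image under \<open>A\<close> into the range of \<open>E\<close>, and then
  corrected by multiples of \<open>u\<close>, which does not change its image under \<open>E\<close> but removes the component of its image under \<open>A\<close> along \<open>w\<close>.
  The columns of \<open>X\<close> are \<open>u\<close>, \<open>g\<close> and the corrected vectors; those of \<open>Y\<close> are \<open>w\<close>, \<open>Ag\<close> and the images of the corrected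
  vectors under \<open>E\<close>.
\<close>

lemma index_two_reduction:
  fixes E A :: "real^'n^'n" and u :: "real^'n"
  assumes E: "psd E" and u: "norm u = 1" and Eu: "E *v u = 0"
    and ker: "\<And>x. E *v x = 0 \<Longrightarrow> x = (u \<bullet> x) *\<^sub>R u"
    and Au: "A *v u \<noteq> 0" and Askew: "\<And>x. u \<bullet> (A *v x) = - ((A *v u) \<bullet> x)"
  obtains a b :: 'n and X Y C :: "real^'n^'n" where "a \<noteq> b" "invertible X" "invertible Y"
    "E ** X = Y ** inf_block_E a b" "A ** X = Y ** inf_block_A a b C"
proof -
  define w where "w = A *v u"
  have uu: "u \<bullet> u = 1" using u by (simp add: norm_eq_1)
  have w0: "w \<noteq> 0" using Au w_def by simp
  have uw: "u \<bullet> w = 0" using Askew[of u] by (simp add: w_def inner_commute)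
  have uE: "u \<bullet> (E *v x) = 0" for x
    using sym_inner_swap[OF psd_sym[OF E], of u x] Eu by simp
  obtain g where g: "E *v g = w" "u \<bullet> g = 0"
  proof -
    \<comment> \<open>\<open>E\<close> maps the complement of \<open>u\<close> onto itself; adding \<open>uu\<^sup>T\<close> turns this into invertibility.\<close>
    have "x = 0" if "(E + outer u) *v x = 0" for x
    proof -
      have 1: "E *v x + (u \<bullet> x) *\<^sub>R u = 0"
        using that by (simp add: matrix_vector_mult_add_rdistrib outer_mult_vec)
      have "u \<bullet> x = 0" using arg_cong[OF 1, of "inner u"] by (simp add: inner_add_right uE uu)
      then show ?thesis using 1 ker[of x] by simp
    qed
    then have "invertible (E + outer u)"
      using invertible_left_inverse matrix_left_invertible_ker by blast
    then obtain V where "(E + outer u) ** V = mat 1" by (auto simp: invertible_def)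
    then have "(E + outer u) *v (V *v w) = w" by (simp add: matrix_vector_mul_assoc)
    then have 1: "E *v (V *v w) + (u \<bullet> (V *v w)) *\<^sub>R u = w"
      by (simp add: matrix_vector_mult_add_rdistrib outer_mult_vec)
    have "u \<bullet> (V *v w) = 0"
      using arg_cong[OF 1, of "inner u"] by (simp add: inner_add_right uE uu uw)
    with 1 that show thesis by auto
  qed
  have wg: "w \<bullet> g \<noteq> 0"
    using psd_kernel[OF E, of g] g w0 by (auto simp: inner_commute)
  have g0: "g \<noteq> 0" and u0: "u \<noteq> 0" using wg u by auto
  obtain h :: "'n \<Rightarrow> real^'n" and a b where ab: "a \<noteq> b" and ha: "h a = u" and hb: "h b = g"
    and h: "\<And>c. (\<Sum>k\<in>UNIV. c k *\<^sub>R h k) = 0 \<Longrightarrow> \<forall>k. c k = 0"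
    by (rule basis_extending_orthogonal_pair[OF u0 g0 g(2)]) (rule that; assumption)
  define S where "S = - {a, b}"
  \<comment> \<open>\<open>w\<bullet>g = g\<bullet>Eg\<close> is nonzero, so \<open>g\<close> can be used to make the basis orthogonal to \<open>w\<close>.\<close>
  define r where "r k = (w \<bullet> h k) / (w \<bullet> g)" for k
  define p where "p k = h k - r k *\<^sub>R g" for k
  have wp: "w \<bullet> p k = 0" for k using wg by (simp add: p_def r_def inner_diff_right)
  have indep: "s = 0 \<and> t = 0 \<and> (\<forall>k\<in>S. c k = 0)"
    if sum0: "(\<Sum>k\<in>S. c k *\<^sub>R p k) + s *\<^sub>R u + t *\<^sub>R g = 0" for c s t
  proof -
    define d where "d k = (if k = a then s else if k = b then t - (\<Sum>k\<in>S. c k * r k) else c k)" for k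
    have "(\<Sum>k\<in>S. c k *\<^sub>R p k) = (\<Sum>k\<in>S. d k *\<^sub>R h k) - (\<Sum>k\<in>S. c k * r k) *\<^sub>R g"
      unfolding p_def scaleR_diff_right sum_subtractf scaleR_sum_left
      by (auto simp: d_def S_def intro!: arg_cong2[of _ _ _ _ minus] sum.cong)
    then have "(\<Sum>k\<in>S. d k *\<^sub>R h k) = (\<Sum>k\<in>S. c k *\<^sub>R p k) + (\<Sum>k\<in>S. c k * r k) *\<^sub>R g"
      by simp
    then have "(\<Sum>k\<in>UNIV. d k *\<^sub>R h k) = 0"
      using sum0 ab by (simp add: sum_remove2[OF ab] ha hb S_def[symmetric] d_def[of a] d_def[of b] algebra_simps)
    then have d0: "d k = 0" for k using h by blast
    have "c k = 0" if "k \<in> S" for k using d0[of k] that by (simp add: d_def S_def)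
    moreover from this have "s = 0 \<and> t = 0" using d0[of a] d0[of b] ab by (simp add: d_def)
    ultimately show ?thesis by blast
  qed
  define Y where "Y = (\<chi> i k. (if k = a then w else if k = b then A *v g else E *v p k) $ i)"
  have Y: "column a Y = w" "column b Y = A *v g" "\<And>k. k \<in> S \<Longrightarrow> column k Y = E *v p k"
    using ab by (auto simp: Y_def S_def Finite_Cartesian_Product.column_def
        Finite_Cartesian_Product.vec_eq_iff)
  have Ysum: "(\<Sum>k\<in>UNIV. c k *\<^sub>R column k Y)
      = c a *\<^sub>R w + c b *\<^sub>R (A *v g) + (\<Sum>k\<in>S. c k *\<^sub>R (E *v p k))" for c
    by (simp add: sum_remove2[OF ab] Y(1,2) S_def[symmetric] Y(3) cong: sum.cong)
  have Ysum_u: "c b = 0" if "u \<bullet> (\<Sum>k\<in>UNIV. c k *\<^sub>R column k Y) = 0" for c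
  proof -
    have "u \<bullet> (\<Sum>k\<in>UNIV. c k *\<^sub>R column k Y) = - (c b * (w \<bullet> g))"
      unfolding Ysum by (simp add: inner_add_right inner_sum_right uE uw Askew w_def[symmetric])
    then show ?thesis using that wg by simp
  qed
  have invY: "invertible Y"
    unfolding invertible_iff_columns
  proof (intro allI impI)
    fix c k assume c: "(\<Sum>k\<in>UNIV. c k *\<^sub>R column k Y) = 0"
    have cb: "c b = 0" using Ysum_u c by simp
    define x where "x = (\<Sum>k\<in>S. c k *\<^sub>R p k) + c a *\<^sub>R g"
    have "E *v x = 0"
      using c cb unfolding Ysum x_def
      by (simp add: matrix_vector_right_distrib matrix_vector_mult_scaleR g(1)
          vec.sum add.commute)
    then have "x = (u \<bullet> x) *\<^sub>R u" by (rule ker)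
    then obtain \<tau> where "x = \<tau> *\<^sub>R u" by (rule that)
    then have "(\<Sum>k\<in>S. c k *\<^sub>R p k) + (- \<tau>) *\<^sub>R u + c a *\<^sub>R g = 0"
      by (simp add: x_def algebra_simps)
    from indep[OF this] show "c k = 0" using cb by (auto simp: S_def)
  qed
  obtain V where V: "Y ** V = mat 1" using invY by (auto simp: invertible_def)
  \<comment> \<open>Coordinates of \<open>A(p k)\<close> with respect to the columns of \<open>Y\<close>; the coordinate along \<open>Ag\<close> is zero because \<open>Ag\<close> is the only column not orthogonal to \<open>u\<close>.\<close>
  define D where "D k = V *v (A *v p k)" for k
  have Ymul: "Y *v x = (\<Sum>k\<in>UNIV. x $ k *\<^sub>R column k Y)" for x
    by (simp add: matrix_mult_sum scalar_mult_eq_scaleR)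
  have YD: "Y *v D k = A *v p k" for k by (simp add: D_def matrix_vector_mul_assoc matrix_mul_assoc V)
  have Db: "D k $ b = 0" for k
    using Ysum_u[of "\<lambda>j. D k $ j"] YD[of k] Askew[of "p k"] wp[of k]
    by (simp add: Ymul[symmetric] w_def[symmetric])
  \<comment> \<open>As \<open>Au = w\<close>, this removes the coordinate of \<open>A(p k)\<close> along \<open>w\<close>.\<close>
  define q where "q k = p k - D k $ a *\<^sub>R u" for k
  have Eq: "E *v q k = E *v p k" for k
    by (simp add: q_def matrix_vector_mult_diff_distrib matrix_vector_mult_scaleR Eu)
  have Aq: "A *v q k = (\<Sum>j\<in>S. D k $ j *\<^sub>R (E *v p j))" for k
    using YD[of k] Db[of k] unfolding Ymul Ysum q_def
    by (simp add: matrix_vector_mult_diff_distrib matrix_vector_mult_scaleR w_def[symmetric]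
        diff_eq_eq add.commute)
  define X where "X = (\<chi> i k. (if k = a then u else if k = b then g else q k) $ i)"
  have X: "column a X = u" "column b X = g" "\<And>k. k \<in> S \<Longrightarrow> column k X = q k"
    using ab by (auto simp: X_def S_def Finite_Cartesian_Product.column_def
        Finite_Cartesian_Product.vec_eq_iff)
  have invX: "invertible X"
    unfolding invertible_iff_columns
  proof (intro allI impI)
    fix c k assume "(\<Sum>k\<in>UNIV. c k *\<^sub>R column k X) = 0"
    then have 0: "c a *\<^sub>R u + c b *\<^sub>R g + (\<Sum>k\<in>S. c k *\<^sub>R q k) = 0"
      by (simp add: sum_remove2[OF ab] X(1,2) S_def[symmetric] X(3) cong: sum.cong)
    have "(\<Sum>k\<in>S. c k *\<^sub>R q k) = (\<Sum>k\<in>S. c k *\<^sub>R p k) - (\<Sum>k\<in>S. c k * D k $ a) *\<^sub>R u"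
      by (simp add: q_def scaleR_diff_right sum_subtractf scaleR_sum_left)
    with 0 have "(\<Sum>k\<in>S. c k *\<^sub>R p k) + (c a - (\<Sum>k\<in>S. c k * D k $ a)) *\<^sub>R u + c b *\<^sub>R g = 0"
      by (simp add: algebra_simps)
    from indep[OF this] show "c k = 0" by (auto simp: S_def)
  qed
  define C where "C = (\<chi> i j. D j $ i)"
  have split: "k = a \<or> k = b \<or> k \<in> S" for k by (auto simp: S_def)
  have EX: "E ** X = Y ** inf_block_E a b"
  proof (rule matrix_eq_columns)
    fix k
    have cols: "column a (inf_block_E a b) = 0" "column b (inf_block_E a b) = axis a 1"
      "\<And>k. k \<in> S \<Longrightarrow> column k (inf_block_E a b) = axis k 1"
      using ab by (auto simp: inf_block_E_def S_def Finite_Cartesian_Product.column_def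
          Finite_Cartesian_Product.vec_eq_iff axis_def)
    show "column k (E ** X) = column k (Y ** inf_block_E a b)"
      using split[of k] by (auto simp: column_mult cols X Y matrix_vector_mult_basis Eu g Eq)
  qed
  have AX: "A ** X = Y ** inf_block_A a b C"
  proof (rule matrix_eq_columns)
    fix k
    have cols: "column a (inf_block_A a b C) = axis a 1" "column b (inf_block_A a b C) = axis b 1"
      using ab by (auto simp: inf_block_A_def Finite_Cartesian_Product.column_def
          Finite_Cartesian_Product.vec_eq_iff axis_def)
    have "Y *v column k (inf_block_A a b C) = A *v q k" if "k \<in> S"
    proof -
      let ?c = "column k (inf_block_A a b C)"
      have "?c $ a = 0" "?c $ b = 0" "\<And>j. j \<in> S \<Longrightarrow> ?c $ j = D k $ j"
        using ab that by (auto simp: inf_block_A_def S_def Finite_Cartesian_Product.column_def C_def)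
      then show ?thesis unfolding Ymul Ysum Aq by simp
    qed
    then show "column k (A ** X) = column k (Y ** inf_block_A a b C)"
      using split[of k] by (auto simp: column_mult cols X Y matrix_vector_mult_basis w_def)
  qed
  show thesis by (rule that[OF ab invX invY EX AX])
qed

lemma numbering_starting_with:
  fixes a b :: "'n::finite"
  assumes ab: "a \<noteq> b"
  obtains f :: "'n \<Rightarrow> nat" where "bij_betw f UNIV {..<CARD('n)}" "f a = 0" "f b = 1"
proof -
  have c2: "card {a, b} = 2" using ab by simp
  have n2: "2 \<le> CARD('n)" using card_mono[of UNIV "{a, b}"] c2 by simp
  have "card (- {a, b}) = card {2..<CARD('n)}"
    using c2 by (simp add: Compl_eq_Diff_UNIV card_Diff_subset)
  then obtain f1 where f1: "bij_betw f1 (- {a, b}) {2..<CARD('n)}"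
    using finite_same_card_bij[of "- {a, b}" "{2..<CARD('n)}"] by auto
  define f where "f k = (if k = a then 0 else if k = b then 1 else f1 k)" for k
  have "bij_betw f ({a, b} \<union> - {a, b}) ({0, 1} \<union> {2..<CARD('n)})"
  proof (rule bij_betw_combine)
    show "bij_betw f {a, b} {0, 1}" using ab by (auto simp: bij_betw_def f_def inj_on_def)
    show "bij_betw f (- {a, b}) {2..<CARD('n)}"
      using f1 by (subst bij_betw_cong[of _ f f1]) (auto simp: f_def)
  qed auto
  moreover have "{0, 1} \<union> {2..<CARD('n)} = {..<CARD('n)}" using n2 by auto
  ultimately have "bij_betw f UNIV {..<CARD('n)}" by simp
  then show thesis using that ab by (simp add: f_def)
qed

text \<open>
  If \<open>C = S K S\<^sup>-\<^sup>1\<close> with \<open>K\<close> in Jordan form, then \<open>diag(I, S)\<close> commutes with \<open>diag(J\<^sub>2(0), I)\<close> and transforms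
  \<open>diag(I, C)\<close> into \<open>diag(I, K)\<close>, so the finite blocks are those of \<open>K\<close>.
\<close>

lemma kronecker_form_of_reduction:
  fixes E A X Y C :: "real^'n^'n"
  assumes ab: "a \<noteq> b" and X: "invertible X" and Y: "invertible Y"
    and EX: "E ** X = Y ** inf_block_E a b" and AX: "A ** X = Y ** inf_block_A a b C"
  obtains bs where "kronecker_form (E, A) bs" "Infinite 2 \<in> set bs"
proof -
  let ?n = "CARD('n)"
  define m where "m = ?n - 2"
  obtain f :: "'n \<Rightarrow> nat" where f: "bij_betw f UNIV {..<?n}" and fa: "f a = 0" and fb: "f b = 1"
    using numbering_starting_with[OF ab] by metis
  have flt: "f i < ?n" for i using f by (auto simp: bij_betw_def)
  have finj: "f i = f j \<longleftrightarrow> i = j" for i j using f by (auto simp: bij_betw_def inj_on_def)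
  have n: "?n = 2 + m" using flt[of b] fb by (simp add: m_def)
  define g where "g = inv_into UNIV f"
  have gf: "g (f i) = i" for i using f by (simp add: g_def bij_betw_def inv_into_f_f)
  define M where "M = Matrix.mat m m (\<lambda>(i, j). complex_of_real (C $ g (i + 2) $ g (j + 2)))"
  have M: "M \<in> carrier_mat m m" by (simp add: M_def)
  obtain zs where "char_poly M = (\<Prod>z\<leftarrow>zs. [:- z, 1:])"
    using char_poly_factorized[OF M] by blast
  then obtain n_as where "jordan_nf M n_as" using jordan_nf_exists[OF M] by blast
  then have pos: "0 \<notin> fst ` set n_as" and "similar_mat M (jordan_matrix n_as)"
    by (auto simp: jordan_nf_def)
  then obtain S T where wit: "similar_mat_wit M (jordan_matrix n_as) S T"
    by (auto simp: similar_mat_def)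
  have S: "S \<in> carrier_mat m m" and T: "T \<in> carrier_mat m m"
    and JJ: "jordan_matrix n_as \<in> carrier_mat m m" and ST: "S * T = 1\<^sub>m m" and TS: "T * S = 1\<^sub>m m"
    using wit M by (auto simp: similar_mat_wit_def Let_def)
  have JTS: "T * M * S = jordan_matrix n_as"
    using similar_mat_wit_sym[OF wit] by (auto simp: similar_mat_wit_def Let_def)
  define blk where "blk U W = four_block_mat U (0\<^sub>m 2 m) (0\<^sub>m m 2) W" for U W :: "complex mat"
  have blk_carrier: "blk U W \<in> carrier_mat ?n ?n" if "U \<in> carrier_mat 2 2" "W \<in> carrier_mat m m" for U W
    using that n by (auto simp: blk_def)
  have blk_mult: "blk U W * blk U' W' = blk (U * U') (W * W')"
    if "U \<in> carrier_mat 2 2" "W \<in> carrier_mat m m" "U' \<in> carrier_mat 2 2" "W' \<in> carrier_mat m m" for U W U' W'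
    unfolding blk_def
    by (subst mult_four_block_mat[where ?n1.0 = 2 and ?n2.0 = m and ?nr1.0 = 2 and ?nr2.0 = m and ?nc1.0 = 2 and ?nc2.0 = m])
      (use that in auto)
  have blk_one: "blk (1\<^sub>m 2) (1\<^sub>m m) = 1\<^sub>m ?n"
    unfolding blk_def n by (rule four_block_one_mat)
  let ?J2 = "jordan_block 2 (0::complex)"
  define bs where "bs = Infinite 2 # map (\<lambda>(k, z). Finite z k) n_as"
  have dims: "sum_list (map fst n_as) = m" using JJ by (metis carrier_matD(1) jordan_matrix_dim(1))
  have ones: "diag_block_mat (map (\<lambda>x. 1\<^sub>m (fst x)) xs) = (1\<^sub>m (sum_list (map fst xs)) :: complex mat)"
    for xs :: "(nat \<times> complex) list"
    by (induction xs) (auto simp: Let_def)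
  have KE: "diag_block_mat (map block_E bs) = blk ?J2 (1\<^sub>m m)"
    using ones[of n_as] by (simp add: dims bs_def comp_def case_prod_beta Let_def blk_def)
  have "diag_block_mat (map block_A (map (\<lambda>(k, z). Finite z k) n_as)) = jordan_matrix n_as"
    by (simp add: jordan_matrix_def comp_def case_prod_beta')
  then have KA: "diag_block_mat (map block_A bs) = blk (1\<^sub>m 2) (jordan_matrix n_as)"
    by (simp add: dims bs_def Let_def blk_def)
  have f2: "2 \<le> f i" if "i \<noteq> a" "i \<noteq> b" for i
  proof -
    have "f i \<noteq> 0" "f i \<noteq> 1" using that finj[of i a] finj[of i b] fa fb by auto
    then show ?thesis by simp
  qed
  have cases: "i = a \<or> i = b \<or> i \<noteq> a \<and> i \<noteq> b \<and> 2 \<le> f i" for i using f2 by blast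
  have blk_entry: "to_vec_mat f (blk U W) $ i $ j =
      (if f i < 2 then if f j < 2 then U $$ (f i, f j) else 0
       else if f j < 2 then 0 else W $$ (f i - 2, f j - 2))"
    if "U \<in> carrier_mat 2 2" "W \<in> carrier_mat m m" for U W i j
    using that flt[of i] flt[of j] by (auto simp: blk_def n)
  have lt_m: "f i - 2 < m" if "2 \<le> f i" for i using that flt[of i] n by simp
  have sub_eq: "f i - 2 = f j - 2 \<longleftrightarrow> i = j" if "2 \<le> f i" "2 \<le> f j" for i j
    using that finj[of i j] by auto
  have M_entry: "M $$ (i, j) = complex_of_real (C $ g (i + 2) $ g (j + 2))" if "i < m" "j < m" for i j
    using that by (simp add: M_def)
  have g2: "g (Suc (Suc (f i - 2))) = i" if "2 \<le> f i" for i
    using that gf[of i] by (metis Suc_1 Suc_diff_le add_2_eq_Suc le_add_diff_inverse)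
  have c1: "1\<^sub>m 2 \<in> carrier_mat 2 2" "?J2 \<in> carrier_mat 2 2" "1\<^sub>m m \<in> carrier_mat m m" by simp_all
  have E0: "to_vec_mat f (blk ?J2 (1\<^sub>m m)) = complexify (inf_block_E a b)"
  proof -
    have "to_vec_mat f (blk ?J2 (1\<^sub>m m)) $ i $ j = complexify (inf_block_E a b) $ i $ j" for i j
      unfolding blk_entry[OF c1(2,3)] using cases[of i] cases[of j] ab
      by (elim disjE; auto simp: fa fb inf_block_E_def lt_m sub_eq)
    then show ?thesis by (simp only: Finite_Cartesian_Product.vec_eq_iff) simp
  qed
  have A0: "to_vec_mat f (blk (1\<^sub>m 2) M) = complexify (inf_block_A a b C)"
  proof -
    have "to_vec_mat f (blk (1\<^sub>m 2) M) $ i $ j = complexify (inf_block_A a b C) $ i $ j" for i j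
      unfolding blk_entry[OF c1(1) M] using cases[of i] cases[of j] ab
      by (elim disjE; auto simp: fa fb inf_block_A_def lt_m M_entry g2)
    then show ?thesis by (simp only: Finite_Cartesian_Product.vec_eq_iff) simp
  qed
  obtain V where V: "V ** Y = mat 1" and V': "Y ** V = mat 1" using Y by (auto simp: invertible_def)
  define DS where "DS = to_vec_mat f (blk (1\<^sub>m 2) S)"
  define DT where "DT = to_vec_mat f (blk (1\<^sub>m 2) T)"
  note cs = c1 S T M JJ
  have "DS ** DT = mat 1"
    unfolding DS_def DT_def
    by (simp add: to_vec_mat_mult[OF f, symmetric] blk_carrier blk_mult cs ST blk_one to_vec_mat_one[OF f])
  then have inv: "invertible DS" "invertible DT"
    unfolding invertible_def using matrix_left_right_inverse by blast+
  have DE: "DT ** to_vec_mat f (blk ?J2 (1\<^sub>m m)) ** DS = to_vec_mat f (blk ?J2 (1\<^sub>m m))"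
    unfolding DS_def DT_def
    by (simp add: to_vec_mat_mult[OF f, symmetric] blk_carrier blk_mult cs TS
        right_mult_one_mat[OF T])
  have DA: "DT ** to_vec_mat f (blk (1\<^sub>m 2) M) ** DS = to_vec_mat f (blk (1\<^sub>m 2) (jordan_matrix n_as))"
    unfolding DS_def DT_def
    by (simp add: to_vec_mat_mult[OF f, symmetric] blk_carrier blk_mult cs JTS mult_carrier_mat[OF T M])
  define P where "P = DT ** complexify V"
  define Q where "Q = complexify X ** DS"
  have inv_V: "invertible V" using V V' by (auto simp: invertible_def)
  have invPQ: "invertible P" "invertible Q"
    unfolding P_def Q_def using inv X inv_V by (simp_all add: invertible_mult complexify_invertible)
  have red: "P ** complexify B ** Q = DT ** complexify K ** DS" if "B ** X = Y ** K" for B K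
  proof -
    have "P ** complexify B ** Q = DT ** complexify (V ** (B ** X)) ** DS"
      by (simp add: P_def Q_def complexify_mult matrix_mul_assoc)
    also have "V ** (B ** X) = K" by (simp add: that matrix_mul_assoc V)
    finally show ?thesis .
  qed
  have form: "P ** complexify E ** Q = to_vec_mat f (blk ?J2 (1\<^sub>m m))"
    "P ** complexify A ** Q = to_vec_mat f (blk (1\<^sub>m 2) (jordan_matrix n_as))"
    by (simp_all add: red[OF EX] red[OF AX] E0[symmetric] A0[symmetric] DE DA)
  have proper: "\<forall>b\<in>set bs. proper_block b" using pos by (force simp: bs_def)
  have "kronecker_form (E, A) bs"
    unfolding kronecker_form_def Let_def KE KA fst_conv snd_conv to_vec_mat_def[symmetric]
    using proper invPQ f form blk_carrier[OF c1(2,3)] blk_carrier[OF c1(1) JJ] by blast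
  then show thesis using that by (simp add: bs_def)
qed

section \<open>Norms of structured perturbations\<close>

text \<open>
  The squared Frobenius norm of \<open>\<Delta>\<^sub>Y\<^sup>u\<close> for a unit vector \<open>u\<close> and symmetric \<open>Y\<close>.
\<close>

definition deflation_cost :: "real^'n \<Rightarrow> real^'n^'n \<Rightarrow> real" where
  "deflation_cost u Y = 2 * (norm ((mat 1 - outer u) *v (Y *v u)))\<^sup>2 + (u \<bullet> (Y *v u))\<^sup>2"

lemma deflation_cost_eq:
  "norm u = 1 \<Longrightarrow> deflation_cost u Y = 2 * (norm (Y *v u))\<^sup>2 - (u \<bullet> (Y *v u))\<^sup>2"
  by (simp add: deflation_cost_def proj_mult_vec norm_proj_sq)

lemma deflation_cost_bounds:
  assumes "norm u = 1"
  shows "(norm (Y *v u))\<^sup>2 \<le> deflation_cost u Y" "deflation_cost u Y \<le> 2 * (norm (Y *v u))\<^sup>2"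
proof -
  have "0 \<le> (norm (Y *v u))\<^sup>2 - (u \<bullet> (Y *v u))\<^sup>2"
    by (simp add: norm_proj_sq[OF assms, symmetric])
  then show "(norm (Y *v u))\<^sup>2 \<le> deflation_cost u Y" by (simp add: deflation_cost_eq[OF assms])
  show "deflation_cost u Y \<le> 2 * (norm (Y *v u))\<^sup>2" by (simp add: deflation_cost_eq[OF assms])
qed

lemma continuous_on_deflation_cost [continuous_intros]:
  "continuous_on S (\<lambda>u. deflation_cost u Y)"
  unfolding deflation_cost_def proj_mult_vec by (intro continuous_intros)

lemma norm_Delta_symmetric:
  assumes u: "norm u = 1" and "transpose Y = Y"
  shows "(norm (Delta u Y))\<^sup>2 = deflation_cost u Y"
  using norm_Delta_sq[OF u, of Y] by (simp only: assms(2) deflation_cost_eq[OF u])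

lemma norm_Delta_skew:
  assumes u: "norm u = 1" and J: "skew Y"
  shows "(norm (Delta u Y))\<^sup>2 = 2 * (norm (Y *v u))\<^sup>2"
  using norm_Delta_sq[OF u, of Y]
  by (simp only: J[unfolded skew_def] neg_matrix_mult_vec norm_minus_cancel skew_inner_self[OF J]) simp

text \<open>
  Skew and symmetric matrices are orthogonal for the Frobenius inner product.
\<close>

lemma norm_pencil_sq:
  assumes K: "skew K" and S: "transpose S = S"
  shows "(norm (X, K - S))\<^sup>2 = (norm X)\<^sup>2 + (norm K)\<^sup>2 + (norm S)\<^sup>2"
proof -
  have "(norm (K - S))\<^sup>2 = (norm K)\<^sup>2 + (norm S)\<^sup>2"
    using skew_sym_orthogonal[OF S K]
    by (simp add: power2_norm_eq_inner inner_diff_left inner_diff_right inner_commute)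
  then show ?thesis by (simp add: norm_Pair)
qed

lemma skew_diff: "skew A \<Longrightarrow> skew B \<Longrightarrow> skew (A - B)"
  by (simp add: skew_def transpose_diff)

lemma transpose_scaleR: "transpose (c *\<^sub>R A) = c *\<^sub>R transpose A" for A :: "real^'n^'m"
  by (simp add: Finite_Cartesian_Product.vec_eq_iff Finite_Cartesian_Product.transpose_def)

lemma skew_add_scaleR: "skew A \<Longrightarrow> skew B \<Longrightarrow> skew (A + c *\<^sub>R B)"
  by (simp add: skew_def transpose_add transpose_scaleR)

lemma skew_0: "skew 0"
  by (simp add: skew_def Finite_Cartesian_Product.vec_eq_iff Finite_Cartesian_Product.transpose_def)

lemma perturbation_in_dh_pencils:
  assumes "psd E" "psd R" "skew J" and D: "(E, J - R) + D \<in> dh_pencils"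
  obtains E' J' R' where "psd E'" "skew J'" "psd R'" "(E, J - R) + D = (E', J' - R')"
    "(norm D)\<^sup>2 = (norm (E' - E))\<^sup>2 + (norm (J' - J))\<^sup>2 + (norm (R' - R))\<^sup>2"
proof -
  obtain E' J' R' where *: "psd E'" "skew J'" "psd R'" "(E, J - R) + D = (E', J' - R')"
    using D by (auto simp: dh_pencils_def)
  have "D = (E', J' - R') - (E, J - R)" using *(4) by (metis add_diff_cancel_left')
  then have "D = (E' - E, (J' - J) - (R' - R))" by (simp add: algebra_simps)
  then have "(norm D)\<^sup>2 = (norm (E' - E))\<^sup>2 + (norm (J' - J))\<^sup>2 + (norm (R' - R))\<^sup>2"
    using assms * by (simp only:) (intro norm_pencil_sq skew_diff, auto simp: transpose_diff psd_sym)
  with * that show thesis by blast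
qed

lemma deflation_cost_le_sym:
  assumes u: "norm u = 1" and "psd Y" "psd Y'" "Y' *v u = 0"
  shows "deflation_cost u Y \<le> (norm (Y' - Y))\<^sup>2"
proof -
  have "Y + (Y' - Y) = Y'" by simp
  then have "(norm (Y *v u))\<^sup>2 + (norm (transpose Y *v u))\<^sup>2 - (u \<bullet> (Y *v u))\<^sup>2 \<le> (norm (Y' - Y))\<^sup>2"
    using norm_ge_deflation[OF u, of Y "Y' - Y"] assms(4) psd_sym[OF assms(3)] by (simp only: simp_thms)
  then show ?thesis unfolding psd_sym[OF assms(2)] deflation_cost_eq[OF u] by linarith
qed

lemma deflation_cost_le_skew:
  assumes u: "norm u = 1" and "skew Y" "skew Y'" "Y' *v u = 0"
  shows "2 * (norm (Y *v u))\<^sup>2 \<le> (norm (Y' - Y))\<^sup>2"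
proof -
  have "Y + (Y' - Y) = Y'" by simp
  moreover have "transpose Y' *v u = 0"
    by (simp only: assms(3)[unfolded skew_def] neg_matrix_mult_vec assms(4)) simp
  ultimately have "(norm (Y *v u))\<^sup>2 + (norm (transpose Y *v u))\<^sup>2 - (u \<bullet> (Y *v u))\<^sup>2 \<le> (norm (Y' - Y))\<^sup>2"
    using norm_ge_deflation[OF u, of Y "Y' - Y"] assms(4) by (simp only: simp_thms)
  then show ?thesis
    by (simp only: assms(2)[unfolded skew_def] neg_matrix_mult_vec norm_minus_cancel
        skew_inner_self[OF assms(2)]) simp
qed

section \<open>Instability and index\<close>

text \<open>
  Singularity and eigenvalues in the open right half plane give a kernel vector common to all three matrices; a Jordan
  chain of length two gives a complex vector whose real and imaginary parts lie in the kernels of \<open>E\<close> and \<open>R\<close>.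
\<close>

lemma unstable_common_kernel:
  fixes E J R :: "real^'n^'n"
  assumes E: "psd E" and R: "psd R" and J: "skew J" and unst: "\<not> stable_pencil (E, J - R)"
  shows "\<exists>u. norm u = 1 \<and> E *v u = 0 \<and> R *v u = 0"
proof -
  have unit: "\<exists>u. norm u = 1 \<and> E *v u = 0 \<and> R *v u = 0"
    if "v \<noteq> 0" "E *v re_vec v = 0" "E *v im_vec v = 0" "R *v re_vec v = 0" "R *v im_vec v = 0" for v
  proof -
    have "re_vec v \<noteq> 0 \<or> im_vec v \<noteq> 0" using that(1) re_im_vec_eq_0 by blast
    then show ?thesis
      using unit_kernel_vector[of "re_vec v" E R 0] unit_kernel_vector[of "im_vec v" E R 0] that by auto
  qed
  consider "singular_pencil (E, J - R)"
    | z where "finite_eigenvalue (E, J - R) z" "0 < Re z"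
    | z where "Re z = 0" "\<not> max_jordan_block (E, J - R) z \<le> 1"
    | "2 \<le> pencil_index (E, J - R)"
    using unst unfolding stable_pencil_def by force
  then show ?thesis
  proof cases
    case 1
    then show ?thesis using singular_iff_common_kernel[OF E R J] by blast
  next
    case 2
    then show ?thesis using right_half_plane_eigenvalue[OF E R J] by blast
  next
    case 3
    obtain v w where v: "v \<noteq> 0" "complexify (J - R) *v v = z *s (complexify E *v v)"
      and w: "complexify (J - R) *v w = z *s (complexify E *v w) + complexify E *v v"
      by (rule finite_block_chain[OF 3(2), unfolded fst_conv snd_conv]) (rule that)
    show ?thesis by (rule unit[OF v(1) imaginary_chain_kernel[OF E R J 3(1) v(2) w]])
  next
    case 4
    obtain v w where v: "v \<noteq> 0" "complexify E *v v = 0" "complexify (J - R) *v v = complexify E *v w"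
      by (rule infinite_block_chain[OF 4, unfolded fst_conv snd_conv]) (rule that)
    show ?thesis by (rule unit[OF v(1) infinite_chain_kernel[OF E R J v(2,3)]])
  qed
qed

lemma index_two_unstable: "2 \<le> pencil_index L \<Longrightarrow> \<not> stable_pencil L"
  by (auto simp: stable_pencil_def)

lemma singular_unstable: "singular_pencil L \<Longrightarrow> \<not> stable_pencil L"
  by (simp add: stable_pencil_def)

lemma proj_quadratic_form:
  assumes "norm u = 1"
  shows "x \<bullet> ((mat 1 - outer u) *v x) = (norm (x - (u \<bullet> x) *\<^sub>R u))\<^sup>2"
proof -
  have "x \<bullet> ((mat 1 - outer u) *v x) = x \<bullet> x - (u \<bullet> x)\<^sup>2"
    by (simp add: proj_mult_vec inner_diff_right inner_commute power2_eq_square)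
  then show ?thesis by (simp only: norm_proj_sq[OF assms] power2_norm_eq_inner[of x])
qed

text \<open>
  The multiple of the projection makes \<open>u\<close> span the whole kernel of the new \<open>E\<close>; then \<open>Ju\<close>, which is orthogonal
  to \<open>u\<close>, lies in the range of the new \<open>E\<close>, as a chain starting at \<open>u\<close> requires.
\<close>

lemma index_two_pencil:
  fixes E J R :: "real^'n^'n"
  assumes E: "psd E" and R: "psd R" and J: "skew J" and u: "norm u = 1" and Ju: "J *v u \<noteq> 0"
    and s: "0 < s"
  defines "E' \<equiv> compress u E + s *\<^sub>R (mat 1 - outer u)"
  shows "(E', J - compress u R) \<in> dh_pencils" "2 \<le> pencil_index (E', J - compress u R)"
proof -
  have form: "x \<bullet> (E' *v x) = x \<bullet> (compress u E *v x) + s * (norm (x - (u \<bullet> x) *\<^sub>R u))\<^sup>2" for x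
    unfolding E'_def
    by (simp add: matrix_vector_mult_add_rdistrib inner_add_right proj_quadratic_form[OF u]
        scaleR_matrix_vector_assoc[symmetric])
  have cE: "0 \<le> x \<bullet> (compress u E *v x)" for x using psd_compress[OF E] by (simp add: psd_def)
  have "transpose E' = E'"
    by (simp add: E'_def transpose_add transpose_scaleR transpose_proj psd_sym[OF psd_compress[OF E]])
  then have E': "psd E'" using cE s by (simp add: psd_def form)
  have cR: "psd (compress u R)" by (rule psd_compress[OF R])
  show "(E', J - compress u R) \<in> dh_pencils" using E' J cR by (auto simp: dh_pencils_def)
  have uu: "u \<bullet> u = 1" using u by (simp add: norm_eq_1)
  have E'u: "E' *v u = 0"
    by (simp add: E'_def matrix_vector_mult_add_rdistrib compress_kernel[OF u] proj_mult_vec uu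
        scaleR_matrix_vector_assoc[symmetric])
  have ker: "x = (u \<bullet> x) *\<^sub>R u" if "E' *v x = 0" for x
  proof -
    have "x \<bullet> (compress u E *v x) + s * (norm (x - (u \<bullet> x) *\<^sub>R u))\<^sup>2 = 0"
      using form[of x] that by simp
    then have "s * (norm (x - (u \<bullet> x) *\<^sub>R u))\<^sup>2 = 0"
      using cE[of x] s by (smt (verit) zero_le_power2 mult_nonneg_nonneg)
    then show ?thesis using s by simp
  qed
  have Au: "(J - compress u R) *v u = J *v u"
    by (simp add: matrix_vector_mult_diff_rdistrib compress_kernel[OF u])
  have Aneq: "(J - compress u R) *v u \<noteq> 0" using Ju Au by simp
  have Askew: "u \<bullet> ((J - compress u R) *v x) = - (((J - compress u R) *v u) \<bullet> x)" for x
    unfolding Au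
    using skew_inner_swap[OF J, of u x] sym_inner_swap[OF psd_sym[OF cR], of u x]
    by (simp add: matrix_vector_mult_diff_rdistrib inner_diff_right compress_kernel[OF u] inner_commute)
  obtain a b :: 'n and X Y C :: "real^'n^'n" where red: "a \<noteq> b" "invertible X" "invertible Y"
    "E' ** X = Y ** inf_block_E a b" "(J - compress u R) ** X = Y ** inf_block_A a b C"
    by (rule index_two_reduction[OF E' u E'u ker Aneq Askew]) (assumption | rule that)+
  obtain bs where "kronecker_form (E', J - compress u R) bs" "Infinite 2 \<in> set bs"
    by (rule kronecker_form_of_reduction[OF red]) (rule that)
  then show "2 \<le> pencil_index (E', J - compress u R)"
    unfolding pencil_index_def
    by (intro Max_ge finite.insertI infinite_block_sizes_finite) blast
qed

lemma skew_not_annihilating: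
  fixes u :: "real^'n"
  assumes u: "u \<noteq> 0" and n: "2 \<le> CARD('n)"
  obtains K :: "real^'n^'n" where "skew K" "K *v u \<noteq> 0"
proof -
  obtain i where i: "u $ i \<noteq> 0" using u by (auto simp: Finite_Cartesian_Product.vec_eq_iff)
  obtain j :: 'n where j: "j \<noteq> i"
  proof (rule ccontr)
    assume "\<not> thesis"
    then have "UNIV = {i}" using that by blast
    then have "CARD('n) = 1" by (metis card_1_singleton_iff One_nat_def)
    then show False using n by simp
  qed
  define K :: "real^'n^'n" where
    "K = (\<chi> k l. (if k = j \<and> l = i then 1 else 0) - (if k = i \<and> l = j then 1 else 0))"
  have "(K *v u) $ j = (\<Sum>l\<in>UNIV. K $ j $ l * u $ l)"
    by (simp add: matrix_vector_mult_def)
  also have "\<dots> = (\<Sum>l\<in>UNIV. if l = i then u $ l else 0)"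
    by (rule sum.cong) (use j in \<open>auto simp: K_def\<close>)
  finally have "(K *v u) $ j = u $ i" by simp
  then have "K *v u \<noteq> 0" using i by (intro notI) simp
  moreover have "skew K"
    by (simp add: skew_def K_def Finite_Cartesian_Product.vec_eq_iff Finite_Cartesian_Product.transpose_def conj_commute)
  ultimately show thesis using that by blast
qed

section \<open>The distances\<close>

text \<open>
  The lower bound compares with the form at the minimizer of the cost, the upper bound with the cost at an eigenvector.
\<close>

lemma minimum_between_lambda_min:
  fixes X :: "real^'n^'n"
  assumes sym: "transpose X = X" and u: "norm u = 1"
    and min: "\<And>v. norm v = 1 \<Longrightarrow> c u \<le> c v"
    and low: "\<And>v. norm v = 1 \<Longrightarrow> v \<bullet> (X *v v) \<le> c v"
    and upp: "\<And>v. norm v = 1 \<Longrightarrow> c v \<le> 2 * (v \<bullet> (X *v v))"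
  shows "sqrt (lambda_min X) \<le> sqrt (c u)" "sqrt (c u) \<le> sqrt (2 * lambda_min X)"
proof -
  obtain w where w: "norm w = 1" "w \<bullet> (X *v w) = lambda_min X"
    and le: "\<And>v. norm v = 1 \<Longrightarrow> lambda_min X \<le> v \<bullet> (X *v v)"
    by (rule lambda_min_rayleigh[OF sym]) (rule that; assumption)
  show "sqrt (lambda_min X) \<le> sqrt (c u)" using le[OF u] low[OF u] by simp
  show "sqrt (c u) \<le> sqrt (2 * lambda_min X)" using min[OF w(1)] upp[OF w(1)] w(2) by simp
qed

lemma singular_perturbation_ge:
  fixes E J R :: "real^'n^'n"
  assumes psd: "psd E" "psd R" "skew J"
    and D: "(E, J - R) + D \<in> dh_pencils" "singular_pencil ((E, J - R) + D)"
  obtains u where "norm u = 1"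
    "2 * (norm (J *v u))\<^sup>2 + deflation_cost u E + deflation_cost u R \<le> (norm D)\<^sup>2"
proof -
  obtain E' J' R' where p: "psd E'" "skew J'" "psd R'" "(E, J - R) + D = (E', J' - R')"
    and n: "(norm D)\<^sup>2 = (norm (E' - E))\<^sup>2 + (norm (J' - J))\<^sup>2 + (norm (R' - R))\<^sup>2"
    using perturbation_in_dh_pencils[OF psd D(1)] by blast
  obtain u where u: "norm u = 1" "E' *v u = 0" "R' *v u = 0" "J' *v u = 0"
    using D(2) singular_iff_common_kernel[OF p(1,3,2)] p(4) by auto
  show thesis
    by (rule that[OF u(1)])
      (use n deflation_cost_le_sym[OF u(1) psd(1) p(1) u(2)] deflation_cost_le_sym[OF u(1) psd(2) p(3) u(3)]
        deflation_cost_le_skew[OF u(1) psd(3) p(2) u(4)] in linarith)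
qed

lemma unstable_perturbation_ge:
  fixes E J R :: "real^'n^'n"
  assumes psd: "psd E" "psd R" "skew J"
    and D: "(E, J - R) + D \<in> dh_pencils" "\<not> stable_pencil ((E, J - R) + D)"
  obtains u where "norm u = 1" "deflation_cost u E + deflation_cost u R \<le> (norm D)\<^sup>2"
proof -
  obtain E' J' R' where p: "psd E'" "skew J'" "psd R'" "(E, J - R) + D = (E', J' - R')"
    and n: "(norm D)\<^sup>2 = (norm (E' - E))\<^sup>2 + (norm (J' - J))\<^sup>2 + (norm (R' - R))\<^sup>2"
    using perturbation_in_dh_pencils[OF psd D(1)] by blast
  obtain u where u: "norm u = 1" "E' *v u = 0" "R' *v u = 0"
    using D(2) unstable_common_kernel[OF p(1,3,2)] p(4) by auto
  have "0 \<le> (norm (J' - J))\<^sup>2" by simp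
  then show thesis
    by (intro that[OF u(1)])
      (use n deflation_cost_le_sym[OF u(1) psd(1) p(1) u(2)] deflation_cost_le_sym[OF u(1) psd(2) p(3) u(3)]
        in linarith)
qed

lemma Delta_perturbation:
  fixes E J R :: "real^'n^'n"
  assumes psd: "psd E" "psd R" "skew J" and u: "norm u = 1"
  defines "D \<equiv> (Delta u E, Delta u J - Delta u R)"
  shows "(E, J - R) + D \<in> dh_pencils" "singular_pencil ((E, J - R) + D)"
    "norm D = sqrt (2 * (norm (J *v u))\<^sup>2 + deflation_cost u E + deflation_cost u R)"
proof -
  have eq: "(E, J - R) + D = (compress u E, compress u J - compress u R)"
    by (simp add: D_def Delta_eq)
  note c = psd_compress[OF psd(1), of u] psd_compress[OF psd(2), of u] skew_compress[OF psd(3), of u]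
  show "(E, J - R) + D \<in> dh_pencils" using c unfolding eq dh_pencils_def by blast
  show "singular_pencil ((E, J - R) + D)"
    unfolding eq singular_iff_common_kernel[OF c] using u by (auto simp: compress_kernel)
  have "skew (Delta u J)" unfolding Delta_eq by (rule skew_diff[OF c(3) psd(3)])
  moreover have "transpose (Delta u R) = Delta u R"
    by (simp add: Delta_eq transpose_diff psd_sym[OF c(2)] psd_sym[OF psd(2)])
  ultimately have "(norm D)\<^sup>2 = 2 * (norm (J *v u))\<^sup>2 + deflation_cost u E + deflation_cost u R"
    unfolding D_def
    by (simp add: norm_pencil_sq norm_Delta_symmetric[OF u] norm_Delta_skew[OF u] psd psd_sym)
  then show "norm D = sqrt (2 * (norm (J *v u))\<^sup>2 + deflation_cost u E + deflation_cost u R)"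
    by (metis norm_ge_zero real_sqrt_unique)
qed

text \<open>
  The minimal perturbation that creates a common kernel vector of \<open>E\<close> and \<open>R\<close> need not produce index two,
  but arbitrarily small further perturbations do.
\<close>

lemma index_two_perturbation:
  fixes E J R :: "real^'n^'n"
  assumes psd: "psd E" "psd R" "skew J" and u: "norm u = 1"
    and ex: "J *v u \<noteq> 0 \<or> 2 \<le> CARD('n)" and e: "0 < e"
  obtains D where "(E, J - R) + D \<in> dh_pencils" "2 \<le> pencil_index ((E, J - R) + D)"
    "norm D \<le> sqrt (deflation_cost u E + deflation_cost u R) + e"
proof -
  have u0: "u \<noteq> 0" using u by auto
  obtain K where K: "skew K" "\<And>s. 0 < s \<Longrightarrow> (J + s *\<^sub>R K) *v u \<noteq> 0"
  proof (cases "J *v u = 0")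
    case True
    then obtain K :: "real^'n^'n" where "skew K" "K *v u \<noteq> 0"
      using skew_not_annihilating[OF u0] ex by blast
    then show thesis using that[of K] True
      by (simp add: matrix_vector_mult_add_rdistrib scaleR_matrix_vector_assoc[symmetric])
  next
    case False
    then show thesis using that[of 0] skew_0 by simp
  qed
  define B where "B = (mat 1 - outer u, K)"
  define s where "s = e / (norm B + 1)"
  have nB: "0 < norm B + 1" by (simp add: add_nonneg_pos)
  then have s: "0 < s" using e by (simp add: s_def)
  define D0 where "D0 = (Delta u E, - Delta u R)"
  define D where "D = D0 + s *\<^sub>R B"
  have sK: "skew (J + s *\<^sub>R K)" by (rule skew_add_scaleR[OF psd(3) K(1)])
  have eq: "(E, J - R) + D = (compress u E + s *\<^sub>R (mat 1 - outer u), (J + s *\<^sub>R K) - compress u R)"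
    by (simp add: D_def D0_def B_def Delta_eq algebra_simps)
  have "transpose (Delta u R) = Delta u R"
    by (simp add: Delta_eq transpose_diff psd_sym psd_compress psd)
  then have "(norm D0)\<^sup>2 = deflation_cost u E + deflation_cost u R"
    using norm_pencil_sq[OF skew_0, of "Delta u R" "Delta u E"] unfolding D0_def
    by (simp add: norm_Delta_symmetric[OF u] psd psd_sym)
  then have D0: "norm D0 = sqrt (deflation_cost u E + deflation_cost u R)"
    by (metis norm_ge_zero real_sqrt_unique)
  have "norm D \<le> norm D0 + s * norm B"
    unfolding D_def using norm_triangle_ineq[of D0 "s *\<^sub>R B"] s by simp
  also have "s * norm B \<le> e"
    using e nB by (simp add: s_def pos_divide_le_eq algebra_simps)
  finally have "norm D \<le> sqrt (deflation_cost u E + deflation_cost u R) + e" using D0 by simp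
  then show thesis
    using that index_two_pencil[OF psd(1,2) sK u K(2)[OF s] s] unfolding eq[symmetric] by blast
qed

lemma d_sing_eq_minimum:
  fixes E J R :: "real^'n^'n"
  assumes psd: "psd E" "psd R" "skew J" and u: "norm u = 1"
    and min: "\<And>v. norm v = 1 \<Longrightarrow>
      2 * (norm (J *v u))\<^sup>2 + deflation_cost u E + deflation_cost u R
      \<le> 2 * (norm (J *v v))\<^sup>2 + deflation_cost v E + deflation_cost v R"
  shows "d_sing (E, J - R)
    = ereal (sqrt (2 * (norm (J *v u))\<^sup>2 + deflation_cost u E + deflation_cost u R))"
proof (rule antisym)
  let ?c = "\<lambda>v. 2 * (norm (J *v v))\<^sup>2 + deflation_cost v E + deflation_cost v R"
  show "d_sing (E, J - R) \<le> ereal (sqrt (?c u))"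
    unfolding d_sing_def
    by (rule Inf_lower) (use Delta_perturbation[OF psd u] in \<open>metis (mono_tags, lifting) mem_Collect_eq\<close>)
  show "ereal (sqrt (?c u)) \<le> d_sing (E, J - R)"
    unfolding d_sing_def
  proof (rule Inf_greatest, clarify)
    fix D assume D: "(E, J - R) + D \<in> dh_pencils" "singular_pencil ((E, J - R) + D)"
    obtain v where "norm v = 1" "?c v \<le> (norm D)\<^sup>2"
      using singular_perturbation_ge[OF psd D] by blast
    then have "?c u \<le> (norm D)\<^sup>2" using min[of v] by linarith
    then show "ereal (sqrt (?c u)) \<le> ereal (norm D)" by (simp add: real_le_lsqrt)
  qed
qed

lemma d_inst_le_d_hi: "d_inst L \<le> d_hi L"
  unfolding d_inst_def d_hi_def
  by (rule Inf_superset_mono) (use index_two_unstable in blast)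

lemma minimum_le_d_inst:
  fixes E J R :: "real^'n^'n"
  assumes psd: "psd E" "psd R" "skew J"
    and min: "\<And>v. norm v = 1 \<Longrightarrow> deflation_cost u E + deflation_cost u R
      \<le> deflation_cost v E + deflation_cost v R"
  shows "ereal (sqrt (deflation_cost u E + deflation_cost u R)) \<le> d_inst (E, J - R)"
  unfolding d_inst_def
proof (rule Inf_greatest, clarify)
  fix D assume D: "(E, J - R) + D \<in> dh_pencils" "\<not> stable_pencil ((E, J - R) + D)"
  obtain v where "norm v = 1" "deflation_cost v E + deflation_cost v R \<le> (norm D)\<^sup>2"
    using unstable_perturbation_ge[OF psd D] by blast
  then have "deflation_cost u E + deflation_cost u R \<le> (norm D)\<^sup>2" using min[of v] by linarith
  then show "ereal (sqrt (deflation_cost u E + deflation_cost u R)) \<le> ereal (norm D)"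
    by (simp add: real_le_lsqrt)
qed

lemma d_hi_le:
  fixes E J R :: "real^'n^'n"
  assumes psd: "psd E" "psd R" "skew J" and u: "norm u = 1"
    and ex: "J *v u \<noteq> 0 \<or> 2 \<le> CARD('n)"
  shows "d_hi (E, J - R) \<le> ereal (sqrt (deflation_cost u E + deflation_cost u R))"
proof (rule ereal_le_epsilon2)
  fix e :: real assume "0 < e"
  then obtain D where D: "(E, J - R) + D \<in> dh_pencils" "2 \<le> pencil_index ((E, J - R) + D)"
    "norm D \<le> sqrt (deflation_cost u E + deflation_cost u R) + e"
    using index_two_perturbation[OF psd u ex] by blast
  have "d_hi (E, J - R) \<le> ereal (norm D)"
    unfolding d_hi_def by (rule Inf_lower) (use D(1,2) in blast)
  also have "\<dots> \<le> ereal (sqrt (deflation_cost u E + deflation_cost u R)) + ereal e"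
    using D(3) by simp
  finally show "d_hi (E, J - R) \<le> ereal (sqrt (deflation_cost u E + deflation_cost u R)) + ereal e" .
qed

text \<open>
  If \<open>Ju = 0\<close>, the compression at \<open>u\<close> is singular; otherwise pencils of index two come arbitrarily close.
  This covers dimension one, where \<open>J = 0\<close>.
\<close>

lemma d_inst_le:
  fixes E J R :: "real^'n^'n"
  assumes psd: "psd E" "psd R" "skew J" and u: "norm u = 1"
  shows "d_inst (E, J - R) \<le> ereal (sqrt (deflation_cost u E + deflation_cost u R))"
proof (cases "J *v u = 0")
  case True
  note D = Delta_perturbation[OF psd u]
  have "d_inst (E, J - R) \<le> ereal (norm (Delta u E, Delta u J - Delta u R))"
    unfolding d_inst_def by (rule Inf_lower) (use D(1) singular_unstable[OF D(2)] in blast)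
  then show ?thesis using D(3) True by simp
next
  case False
  then show ?thesis using d_hi_le[OF psd u] d_inst_le_d_hi order_trans by blast
qed

lemma transpose_square: "transpose (X ** X) = X ** X" if "transpose X = X" for X :: "real^'n^'n"
  using that by (simp add: matrix_transpose_mul)

lemma inner_square_sym: "u \<bullet> ((X ** X) *v u) = (norm (X *v u))\<^sup>2" if "transpose X = X" for X :: "real^'n^'n"
  using sym_inner_swap[OF that, of u "X *v u"]
  by (simp add: matrix_vector_mul_assoc[symmetric] power2_norm_eq_inner)

lemma neg_square_skew:
  assumes "skew J"
  shows "transpose (- (J ** J)) = - (J ** J)" "u \<bullet> ((- (J ** J)) *v u) = (norm (J *v u))\<^sup>2"
proof -
  have "- (J ** J) = J ** transpose J"
    using assms by (simp add: skew_def Finite_Cartesian_Product.vec_eq_iff matrix_matrix_mult_def sum_negf)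
  then show "transpose (- (J ** J)) = - (J ** J)" by (simp add: matrix_transpose_mul)
  show "u \<bullet> ((- (J ** J)) *v u) = (norm (J *v u))\<^sup>2"
    using skew_inner_swap[OF assms, of u "J *v u"]
    by (simp add: neg_matrix_mult_vec matrix_vector_mul_assoc[symmetric] power2_norm_eq_inner)
qed

text \<open>
  Compactness of the sphere provides minimizers of both costs; the attaining singular pencil is the compression at a
  minimizer of the first.
\<close>

theorem theorem6:
  fixes E J R :: "real^'n^'n"
  assumes "psd E" and "psd R" and "skew J"
  shows
    "(\<exists>u. norm u = 1 \<and>
        (let D = (Delta u E, Delta u J - Delta u R) in
           (E, J - R) + D \<in> dh_pencils \<and> singular_pencil ((E, J - R) + D)
           \<and> d_sing (E, J - R) = ereal (norm D)))
     \<and> (\<exists>m. is_minimum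
             (\<lambda>u. sqrt (2 * (norm (J *v u))\<^sup>2
                      + 2 * (norm ((mat 1 - outer u) *v (E *v u)))\<^sup>2 + (u \<bullet> (E *v u))\<^sup>2
                      + 2 * (norm ((mat 1 - outer u) *v (R *v u)))\<^sup>2 + (u \<bullet> (R *v u))\<^sup>2))
             {u. norm u = 1} m
           \<and> d_sing (E, J - R) = ereal m)
     \<and> ereal (sqrt (lambda_min (- (J ** J) + R ** R + E ** E))) \<le> d_sing (E, J - R)
     \<and> d_sing (E, J - R) \<le> ereal (sqrt (2 * lambda_min (- (J ** J) + R ** R + E ** E)))
     \<and> (2 \<le> CARD('n) \<longrightarrow> d_hi (E, J - R) = d_inst (E, J - R))
     \<and> (\<exists>m. is_minimum
             (\<lambda>u. sqrt (2 * (norm ((mat 1 - outer u) *v (E *v u)))\<^sup>2 + (u \<bullet> (E *v u))\<^sup>2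
                      + 2 * (norm ((mat 1 - outer u) *v (R *v u)))\<^sup>2 + (u \<bullet> (R *v u))\<^sup>2))
             {u. norm u = 1} m
           \<and> d_inst (E, J - R) = ereal m)
     \<and> ereal (sqrt (lambda_min (E ** E + R ** R))) \<le> d_inst (E, J - R)
     \<and> d_inst (E, J - R) \<le> ereal (sqrt (2 * lambda_min (E ** E + R ** R)))"
proof -
  note psd = assms
  note sym = psd_sym[OF psd(1)] psd_sym[OF psd(2)]
  define cs where "cs u = 2 * (norm (J *v u))\<^sup>2 + deflation_cost u E + deflation_cost u R" for u
  define ci where "ci u = deflation_cost u E + deflation_cost u R" for u
  have cs_eq: "(\<lambda>u. sqrt (2 * (norm (J *v u))\<^sup>2
      + 2 * (norm ((mat 1 - outer u) *v (E *v u)))\<^sup>2 + (u \<bullet> (E *v u))\<^sup>2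
      + 2 * (norm ((mat 1 - outer u) *v (R *v u)))\<^sup>2 + (u \<bullet> (R *v u))\<^sup>2)) = (\<lambda>u. sqrt (cs u))"
    by (simp add: cs_def deflation_cost_def add.assoc)
  have ci_eq: "(\<lambda>u. sqrt (2 * (norm ((mat 1 - outer u) *v (E *v u)))\<^sup>2 + (u \<bullet> (E *v u))\<^sup>2
      + 2 * (norm ((mat 1 - outer u) *v (R *v u)))\<^sup>2 + (u \<bullet> (R *v u))\<^sup>2)) = (\<lambda>u. sqrt (ci u))"
    by (simp add: ci_def deflation_cost_def add.assoc)
  have cont_cs: "continuous_on (sphere 0 1) cs" unfolding cs_def by (intro continuous_intros)
  obtain u where u: "norm u = 1" and u_min: "\<And>v. norm v = 1 \<Longrightarrow> cs u \<le> cs v"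
    by (rule sphere_attains_min[OF cont_cs]) (rule that; assumption)
  have cont_ci: "continuous_on (sphere 0 1) ci" unfolding ci_def by (intro continuous_intros)
  obtain w where w: "norm w = 1" and w_min: "\<And>v. norm v = 1 \<Longrightarrow> ci w \<le> ci v"
    by (rule sphere_attains_min[OF cont_ci]) (rule that; assumption)
  have sing: "d_sing (E, J - R) = ereal (sqrt (cs u))"
    unfolding cs_def by (rule d_sing_eq_minimum[OF psd u u_min[unfolded cs_def]])
  have inst: "d_inst (E, J - R) = ereal (sqrt (ci w))"
    unfolding ci_def
    by (rule antisym[OF d_inst_le[OF psd w] minimum_le_d_inst[OF psd w_min[unfolded ci_def]]])
  have hi: "d_hi (E, J - R) = d_inst (E, J - R)" if "2 \<le> CARD('n)"
    using d_hi_le[OF psd w] that d_inst_le_d_hi[of "(E, J - R)"] inst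
    unfolding ci_def by (intro antisym) auto
  have attained: "(E, J - R) + (Delta u E, Delta u J - Delta u R) \<in> dh_pencils"
    "singular_pencil ((E, J - R) + (Delta u E, Delta u J - Delta u R))"
    "d_sing (E, J - R) = ereal (norm (Delta u E, Delta u J - Delta u R))"
    using Delta_perturbation[OF psd u] sing unfolding cs_def by simp_all
  have min_s: "is_minimum (\<lambda>u. sqrt (cs u)) {u. norm u = 1} (sqrt (cs u))"
    unfolding is_minimum_def using u u_min by auto
  have min_i: "is_minimum (\<lambda>u. sqrt (ci u)) {u. norm u = 1} (sqrt (ci w))"
    unfolding is_minimum_def using w w_min by auto
  define Xs where "Xs = - (J ** J) + R ** R + E ** E"
  define Xi where "Xi = E ** E + R ** R"
  have Xs_sym: "transpose Xs = Xs"
    by (simp only: Xs_def transpose_add neg_square_skew(1)[OF psd(3)] transpose_square[OF sym(1)]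
        transpose_square[OF sym(2)])
  have Xs_form: "v \<bullet> (Xs *v v) = (norm (J *v v))\<^sup>2 + (norm (R *v v))\<^sup>2 + (norm (E *v v))\<^sup>2" for v
    by (simp only: Xs_def matrix_vector_mult_add_rdistrib inner_add_right neg_square_skew(2)[OF psd(3)]
        inner_square_sym[OF sym(1)] inner_square_sym[OF sym(2)])
  have Xi_sym: "transpose Xi = Xi"
    by (simp only: Xi_def transpose_add transpose_square[OF sym(1)] transpose_square[OF sym(2)])
  have Xi_form: "v \<bullet> (Xi *v v) = (norm (E *v v))\<^sup>2 + (norm (R *v v))\<^sup>2" for v
    by (simp only: Xi_def matrix_vector_mult_add_rdistrib inner_add_right
        inner_square_sym[OF sym(1)] inner_square_sym[OF sym(2)])
  have s_low: "v \<bullet> (Xs *v v) \<le> cs v" and s_upp: "cs v \<le> 2 * (v \<bullet> (Xs *v v))"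
    and i_low: "v \<bullet> (Xi *v v) \<le> ci v" and i_upp: "ci v \<le> 2 * (v \<bullet> (Xi *v v))" if "norm v = 1" for v
    using deflation_cost_bounds[OF that, of E] deflation_cost_bounds[OF that, of R]
      zero_le_power2[of "norm (J *v v)"]
    unfolding Xs_form Xi_form cs_def ci_def by (simp_all add: distrib_left add_increasing)
  note s_bounds = minimum_between_lambda_min[OF Xs_sym u u_min s_low s_upp]
  note i_bounds = minimum_between_lambda_min[OF Xi_sym w w_min i_low i_upp]
  show ?thesis
    unfolding cs_eq ci_eq Let_def Xs_def[symmetric] Xi_def[symmetric]
    using u attained min_s min_i sing inst hi s_bounds i_bounds by auto
qed

end
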